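(* Let $v=(2d+1)u$ with $d,u$ positive integers and $v\equiv u\pmod{16}$, where $u=1$ or $u\equiv0\pmod4$. 1. Let $h,k,m,n$ be positive integers with $4h\le n$ and $2k\le m$. If $8hm=4kn=du$, then there exist two ($\mathbb Z_v$-regular) orthogonal cycle decompositions of $K_{2d+1}[u]$ whose cycles all have length $4h$ and $4k$, respectively. 2. Let $\mathbf h=(h_1,h_1,\ldots,h_m,h_m)$ and $\mathbf k=(k_1,k_1,\ldots,k_n,k_n)$ be sequences of positive integers (of lengths $2m$ and $2n$) such that $8s_0(\mathbf h)=4s_0(\mathbf k)=du$, where $s_0$ denotes the sum of all terms of a sequence. If $$\sum_{i=1}^{m}2\min(4h_i,w)\ \ge\ \sum_{j=1}^{w}\kappa'_j\qquad\text{for every }1\le w\le 2n,$$ where $(\kappa'_1,\ldots,\kappa'_{2n})$ is the decreasing (nonincreasing) reordering of $2\mathbf k$, then there exist two ($\mathbb Z_v$-regular) orthogonal cycle decompositions of $K_{2d+1}[u]$ whose multisets of cycle-lengths are ${}^{2v}\mathcal E(4\mathbf h)$ and ${}^{v}\mathcal E(4\mathbf k)$, respectively.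
   Context: $K_{2d+1}[u]$ is the complete equipartite graph with $2d+1$ parts of size $u$; here it is viewed as the Cayley graph on $\mathbb Z_v$ in which two vertices are adjacent iff their difference does not lie in the subgroup $U$ of $\mathbb Z_v$ of order $u$ (for $u=1$ it is the complete graph on $v$ vertices). A cycle decomposition of a graph $\Gamma$ is a set of cycles of $\Gamma$ whose edge-sets partition $E(\Gamma)$. It is $\mathbb Z_v$-regular if it is preserved by every translation $y\mapsto y+g$, $g\in\mathbb Z_v$. Two decompositions $\mathcal F,\mathcal F'$ are orthogonal if $|E(F)\cap E(F')|\le1$ for all $F\in\mathcal F$, $F'\in\mathcal F'$. For a sequence $\mathbf a$ of positive integers, $q\mathbf a$ multiplies all terms by $q$, $\mathcal E(\mathbf a)$ is the multiset of its terms, and ${}^\mu M$ is the multiset union of $\mu$ copies of $M$. *)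

theory Defs
  imports "HOL-Algebra.Elementary_Groups" "HOL-Number_Theory.Cong"
    "HOL-Library.Multiset" "HOL-Library.Disjoint_Sets"
begin

record 'a ugraph =
  verts :: "'a set"
  edges :: "'a set set"

definition cayley_complement :: "'a monoid \<Rightarrow> 'a set \<Rightarrow> 'a ugraph" where
  "cayley_complement G U =
     \<lparr>verts = carrier G,
      edges = {{x, y} | x y. x \<in> carrier G \<and> y \<in> carrier G \<and> x \<otimes>\<^bsub>G\<^esub> inv\<^bsub>G\<^esub> y \<notin> U}\<rparr>"

text \<open>For \<open>0 < d\<close>, \<open>0 < u\<close> and \<open>U\<close> the subgroup of order \<open>u\<close> of the cyclic group of order
  \<open>(2 * d + 1) * u\<close>, the graph \<open>cayley_complement (integer_mod_group ((2 * d + 1) * u)) U\<close> is the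
  complete equipartite graph with \<open>2 * d + 1\<close> parts (the cosets of \<open>U\<close>) of size \<open>u\<close>.
  A subgroup of this order exists:\<close>

lemma subgroup_of_multiples:
  fixes d u :: nat
  assumes "0 < u"
  defines "U \<equiv> (\<lambda>i. int (2 * d + 1) * i) ` {0..<int u}"
  shows "subgroup U (integer_mod_group ((2 * d + 1) * u))" and "card U = u"
proof -
  define v where "v = (2 * d + 1) * u"
  define q where "q = int (2 * d + 1)"
  have v: "int v = q * int u" and q: "0 < q" and v0: "v \<noteq> 0"
    using assms by (simp_all add: v_def q_def algebra_simps)
  have U: "U = (\<lambda>i. q * i) ` {0..<int u}" by (simp add: U_def q_def)
  have mult_in: "(q * z) mod int v \<in> U" for z
  proof -
    have "(q * z) mod int v = q * (z mod int u)" by (simp only: v mult_mod_right)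
    moreover have "z mod int u \<in> {0..<int u}" using assms(1) by simp
    ultimately show ?thesis unfolding U by (rule image_eqI)
  qed
  have sub: "U \<subseteq> carrier (integer_mod_group v)"
    using q v0 by (auto simp: U v carrier_integer_mod_group)
  have "subgroup U (integer_mod_group v)"
  proof (rule group.subgroupI)
    show "U \<noteq> {}" using assms by (auto simp: U)
  next
    fix a assume "a \<in> U"
    then obtain i where "a = q * i" by (auto simp: U)
    then show "inv\<^bsub>integer_mod_group v\<^esub> a \<in> U"
      using sub \<open>a \<in> U\<close> mult_in[of "- i"] by (simp add: subset_iff)
  next
    fix a b assume "a \<in> U" "b \<in> U"
    then obtain i j where "a = q * i" "b = q * j" by (auto simp: U)
    then show "a \<otimes>\<^bsub>integer_mod_group v\<^esub> b \<in> U"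
      using mult_in[of "i + j"] by (simp add: distrib_left)
  qed (use sub in auto)
  then show "subgroup U (integer_mod_group ((2 * d + 1) * u))" by (simp add: v_def)
  show "card U = u"
    using q by (simp add: U card_image inj_on_def)
qed

definition is_cycle :: "'a ugraph \<Rightarrow> bool" where
  "is_cycle C \<longleftrightarrow>
     (\<exists>xs. distinct xs \<and> 3 \<le> length xs \<and> verts C = set xs \<and>
       edges C = {{xs ! i, xs ! (Suc i mod length xs)} | i. i < length xs})"

definition cycle_length :: "'a ugraph \<Rightarrow> nat" where
  "cycle_length C = card (edges C)"

definition subgraph_of :: "'a ugraph \<Rightarrow> 'a ugraph \<Rightarrow> bool" where
  "subgraph_of C \<Gamma> \<longleftrightarrow> verts C \<subseteq> verts \<Gamma> \<and> edges C \<subseteq> edges \<Gamma>"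

definition cycle_decomposition :: "'a ugraph \<Rightarrow> 'a ugraph set \<Rightarrow> bool" where
  "cycle_decomposition \<Gamma> \<F> \<longleftrightarrow>
     (\<forall>C\<in>\<F>. is_cycle C \<and> subgraph_of C \<Gamma>) \<and>
     disjoint_family_on edges \<F> \<and> (\<Union>C\<in>\<F>. edges C) = edges \<Gamma>"

definition translate :: "'a monoid \<Rightarrow> 'a \<Rightarrow> 'a ugraph \<Rightarrow> 'a ugraph" where
  "translate G g C =
     \<lparr>verts = (\<lambda>y. y \<otimes>\<^bsub>G\<^esub> g) ` verts C, edges = (\<lambda>e. (\<lambda>y. y \<otimes>\<^bsub>G\<^esub> g) ` e) ` edges C\<rparr>"

definition regular_under :: "'a monoid \<Rightarrow> 'a ugraph set \<Rightarrow> bool" where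
  "regular_under G \<F> \<longleftrightarrow> (\<forall>g\<in>carrier G. translate G g ` \<F> = \<F>)"

definition orthogonal_decompositions :: "'a ugraph set \<Rightarrow> 'a ugraph set \<Rightarrow> bool" where
  "orthogonal_decompositions \<F> \<F>' \<longleftrightarrow>
     (\<forall>F\<in>\<F>. \<forall>F'\<in>\<F>'. card (edges F \<inter> edges F') \<le> 1)"

definition cycle_lengths :: "'a ugraph set \<Rightarrow> nat multiset" where
  "cycle_lengths \<F> = image_mset cycle_length (mset_set \<F>)"

text \<open>\<open>twice_each [a\<^sub>1, \<dots>, a\<^sub>m] = [a\<^sub>1, a\<^sub>1, \<dots>, a\<^sub>m, a\<^sub>m]\<close>\<close>

definition twice_each :: "'b list \<Rightarrow> 'b list" where
  "twice_each xs = concat (map (\<lambda>x. [x, x]) xs)"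

definition scale :: "nat \<Rightarrow> nat list \<Rightarrow> nat list" where
  "scale q xs = map (\<lambda>x. q * x) xs"

definition decreasing_reordering :: "nat list \<Rightarrow> nat list" where
  "decreasing_reordering xs = rev (sort xs)"

end

theory Submission
  imports Defs "HOL-Algebra.Multiplicative_Group"
begin

text \<open>Let \<open>q = 2 * d + 1\<close>. The edges of the graph are the orbits of the differences \<open>0 < a < v / 2\<close>
  with \<open>\<not> q dvd a\<close>. A partition of this set of \<open>d * u\<close> differences into blocks, each of which is the
  list of edge lengths of a cycle with integer vertices, yields a regular decomposition by
  translating those cycles, and two such decompositions are orthogonal if every block of one meets
  every block of the other in at most one difference. The signs of the differences may be chosen
  independently in the two partitions.

  For \<open>\<delta> = d / 2\<close> (if \<open>u = 1\<close>) or \<open>\<delta> = v / 4\<close> (if \<open>4 dvd u\<close>) the difference set is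
  \<open>L \<union> (L + \<delta>)\<close>, where \<open>L\<close> lies in \<open>{1..\<delta>}\<close> and its increasing enumeration consists of pairs of
  consecutive integers. By Gale and Ryser there is a 0/1 matrix with the row sums \<open>r i\<close>
  and column sums \<open>c j\<close>; its ones are labelled row by row with the elements of \<open>L\<close> in increasing
  order. The labels \<open>x\<close> of a row form one block and their shifts \<open>x + \<delta>\<close> another one; a column
  contributes the block of all its \<open>x\<close> and \<open>x + \<delta>\<close>. Row blocks split into pairs \<open>a, a + 1\<close>, whose
  differences cancel when the signs are reversed halfway; in a column block the gaps
  between the \<open>x\<close> reappear between the \<open>x + \<delta>\<close> and cancel in the same way. In both cases a zigzag
  walk with increasing step lengths closes up without repeating a vertex.\<close>

subsection \<open>Matrices with prescribed margins\<close>

text \<open>Supplies the rows of largest remaining sum, which receive the ones of a single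
  column.\<close>

lemma exists_top_subset:
  fixes r :: "'i \<Rightarrow> nat"
  assumes "finite I" "k \<le> card I"
  shows "\<exists>T\<subseteq>I. card T = k \<and> (\<forall>i\<in>T. \<forall>l\<in>I - T. r l \<le> r i)"
  using assms(2)
proof (induction k)
  case 0
  show ?case by (rule exI[of _ "{}"]) auto
next
  case (Suc k)
  then obtain T where T: "T \<subseteq> I" "card T = k" "\<forall>i\<in>T. \<forall>l\<in>I - T. r l \<le> r i"
    by auto
  have finT: "finite T" using T(1) assms(1) finite_subset by blast
  have "I - T \<noteq> {}" using Suc.prems T(1,2) by (metis Diff_eq_empty_iff card_mono finT not_less_eq_eq)
  moreover have "finite (I - T)" using assms(1) by simp
  ultimately have "Max (r ` (I - T)) \<in> r ` (I - T)" by (intro Max_in) auto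
  then obtain x where x: "x \<in> I - T" "r x = Max (r ` (I - T))" by force
  have "\<forall>l\<in>I - T. r l \<le> r x" using \<open>finite (I - T)\<close> x(2) by auto
  then show ?case
    using T x(1) finT by (intro exI[of _ "insert x T"]) auto
qed

text \<open>The sum of \<open>min (r i) w\<close> over all rows adds up the first \<open>w\<close>
  parts of the partition conjugate to \<open>r\<close>, so the inequality is the Gale-Ryser
  dominance condition. The matrix is built greedily, one column at a time, starting with the
  last.\<close>

theorem gale_ryser:
  fixes r :: "'i \<Rightarrow> nat" and c :: "nat \<Rightarrow> nat"
  assumes "finite I"
    and "\<And>i j. i \<le> j \<Longrightarrow> j < N \<Longrightarrow> c j \<le> c i"
    and "\<And>w. w \<le> N \<Longrightarrow> (\<Sum>j<w. c j) \<le> (\<Sum>i\<in>I. min (r i) w)"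
    and "(\<Sum>i\<in>I. r i) = (\<Sum>j<N. c j)"
  shows "\<exists>M. (\<forall>i\<in>I. card {j. j < N \<and> M i j} = r i) \<and> (\<forall>j<N. card {i\<in>I. M i j} = c j)"
  using assms(2-)
proof (induction N arbitrary: r)
  case 0
  then show ?case using assms(1) by (intro exI[of _ "\<lambda>_ _. False"]) auto
next
  case (Suc N)
  \<comment> \<open>The last, smallest column is filled in \<open>k\<close> rows of largest sum. If some chosen row has
    \<open>r i \<le> w\<close>, then all other rows do, and dominance at \<open>w\<close> for the remaining columns follows
    from dominance at \<open>w + 1\<close> for all columns.\<close>
  define k where "k = c N"
  have le: "(\<Sum>j<w. c j) \<le> (\<Sum>i\<in>I. min (r i) w)" if "w \<le> Suc N" for w
    using Suc.prems(2) that by blast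
  \<comment> \<open>Dominance at \<open>w = 1\<close> bounds the largest column sum, hence also the
    last one, by the number of rows with positive sum.\<close>
  have supp: "k \<le> card {i\<in>I. 0 < r i}"
  proof -
    have "c N \<le> c 0" using Suc.prems(1)[of 0 N] by simp
    moreover have "c 0 \<le> (\<Sum>i\<in>I. min (r i) 1)" using le[of 1] by simp
    moreover have "(\<Sum>i\<in>I. min (r i) 1) = (\<Sum>i\<in>I. if 0 < r i then 1 else 0)"
      by (rule sum.cong) auto
    moreover have "\<dots> = card {i\<in>I. 0 < r i}"
      using assms(1) by (simp add: sum.If_cases Int_def)
    ultimately show ?thesis by (simp add: k_def)
  qed
  then have "k \<le> card I" using card_mono[of I "{i\<in>I. 0 < r i}"] assms(1) by auto
  then obtain T where T: "T \<subseteq> I" "card T = k" "\<forall>i\<in>T. \<forall>l\<in>I - T. r l \<le> r i"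
    using exists_top_subset[OF assms(1)] by blast
  have finT: "finite T" using T(1) assms(1) finite_subset by blast
  \<comment> \<open>A chosen row with sum zero would force every unchosen row to have sum zero,
    which leaves fewer than \<open>k\<close> positive rows.\<close>
  have pos: "0 < r i" if "i \<in> T" for i
  proof (rule ccontr)
    assume "\<not> 0 < r i"
    then have "{i\<in>I. 0 < r i} \<subseteq> T - {i}" using T(3) that by force
    then have "card {i\<in>I. 0 < r i} \<le> card T - 1"
      using card_mono[of "T - {i}"] finT that by fastforce
    moreover have "0 < card T" using finT that card_gt_0_iff by blast
    ultimately show False using supp T(2) by simp
  qed
  define r' where "r' i = (if i \<in> T then r i - 1 else r i)" for i
  have split: "(\<Sum>i\<in>I. f i) = (\<Sum>i\<in>I - T. f i) + (\<Sum>i\<in>T. f i)" for f :: "'i \<Rightarrow> nat"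
    using sum.subset_diff[OF T(1) assms(1)] .
  have "\<exists>M. (\<forall>i\<in>I. card {j. j < N \<and> M i j} = r' i) \<and> (\<forall>j<N. card {i\<in>I. M i j} = c j)"
  proof (rule Suc.IH)
    show "c j \<le> c i" if "i \<le> j" "j < N" for i j using Suc.prems(1) that by simp
  next
    fix w assume w: "w \<le> N"
    show "(\<Sum>j<w. c j) \<le> (\<Sum>i\<in>I. min (r' i) w)"
    proof (cases "\<forall>i\<in>T. w < r i")
      case True
      \<comment> \<open>Chosen rows keep at least \<open>w\<close> after losing one, so no truncated
        row sum changes.\<close>
      then have "(\<Sum>i\<in>I. min (r' i) w) = (\<Sum>i\<in>I. min (r i) w)"
        by (intro sum.cong) (auto simp: r'_def)
      then show ?thesis using le[of w] w by simp
    next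
      case False
      then have out: "r l \<le> w" if "l \<in> I - T" for l
        using T(3) that by (meson order_trans linorder_not_less)
      have "(\<Sum>i\<in>I - T. min (r i) (Suc w)) = (\<Sum>i\<in>I - T. min (r' i) w)"
        using out by (intro sum.cong) (auto simp: r'_def min_def le_SucI)
      moreover have "(\<Sum>i\<in>T. min (r i) (Suc w)) = (\<Sum>i\<in>T. min (r' i) w + 1)"
        using pos by (intro sum.cong) (force simp: r'_def min_def)+
      then have "(\<Sum>i\<in>T. min (r i) (Suc w)) = (\<Sum>i\<in>T. min (r' i) w) + k"
        by (simp only: sum.distrib) (simp add: T(2))
      ultimately have "(\<Sum>i\<in>I. min (r i) (Suc w)) = (\<Sum>i\<in>I. min (r' i) w) + k"
        by (simp add: split)
      \<comment> \<open>Column \<open>w\<close> contributes at least the \<open>k\<close> ones by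
        which the row side was lowered.\<close>
      moreover have "k \<le> c w" using Suc.prems(1)[of w N] w by (simp add: k_def)
      ultimately show ?thesis using le[of "Suc w"] w by simp
    qed
  next
    have "(\<Sum>i\<in>T. r i) = (\<Sum>i\<in>T. r' i + 1)"
      using pos by (intro sum.cong) (auto simp: r'_def)
    then have "(\<Sum>i\<in>T. r i) = (\<Sum>i\<in>T. r' i) + k"
      by (simp only: sum.distrib) (simp add: T(2))
    moreover have "(\<Sum>i\<in>I - T. r i) = (\<Sum>i\<in>I - T. r' i)"
      by (intro sum.cong) (auto simp: r'_def)
    ultimately show "(\<Sum>i\<in>I. r' i) = (\<Sum>j<N. c j)"
      using Suc.prems(3) by (simp add: split k_def)
  qed
  then obtain M where M: "\<forall>i\<in>I. card {j. j < N \<and> M i j} = r' i"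
    "\<forall>j<N. card {i\<in>I. M i j} = c j" by blast
  define M' where "M' i j = (if j = N then i \<in> T else M i j)" for i j
  have "card {j. j < Suc N \<and> M' i j} = r i" if i: "i \<in> I" for i
  proof (cases "i \<in> T")
    case True
    then have "{j. j < Suc N \<and> M' i j} = insert N {j. j < N \<and> M i j}"
      by (auto simp: M'_def less_Suc_eq)
    then show ?thesis using M(1) i True pos by (simp add: r'_def)
  next
    case False
    then have "{j. j < Suc N \<and> M' i j} = {j. j < N \<and> M i j}"
      by (auto simp: M'_def less_Suc_eq)
    then show ?thesis using M(1) i False by (simp add: r'_def)
  qed
  moreover have "card {i\<in>I. M' i j} = c j" if "j < Suc N" for j
  proof (cases "j = N")
    case True
    then have "{i\<in>I. M' i j} = T" using T(1) by (auto simp: M'_def)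
    then show ?thesis using T(2) True by (simp add: k_def)
  next
    case False
    then show ?thesis using that M(2) by (simp add: M'_def)
  qed
  ultimately show ?case by blast
qed

subsection \<open>Closed walks with prescribed step lengths\<close>

definition zigzag :: "(nat \<Rightarrow> int) \<Rightarrow> nat \<Rightarrow> int" where
  "zigzag b k = (\<Sum>i<k. (-1) ^ i * b i)"

text \<open>Since the steps grow, each one overshoots: step \<open>i\<close> lands strictly beyond
  every earlier position in its own direction, yet at distance at most \<open>b i\<close> from it.
  The factor \<open>(-1) ^ i\<close> records the direction.\<close>

lemma zigzag_bounds:
  assumes pos: "\<And>i. i < n \<Longrightarrow> 0 < b i"
    and mono: "\<And>i j. i < j \<Longrightarrow> j < n \<Longrightarrow> b i < b j"
    and "j \<le> i" "i < n"
  shows "0 < (-1) ^ i * (zigzag b (Suc i) - zigzag b j) \<and>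
    (-1) ^ i * (zigzag b (Suc i) - zigzag b j) \<le> b i"
  using assms(3-)
proof (induction i)
  case 0
  then show ?case using pos by (simp add: zigzag_def)
next
  case (Suc i)
  have sq: "(-1) ^ i * ((-1) ^ i * x) = x" for x :: int
    by (simp flip: mult.assoc power_add)
  \<comment> \<open>After a reversal the new signed distance is the new step length minus the old
    distance, and the old one lies between 0 and \<open>b i < b (Suc i)\<close>.\<close>
  have step: "(-1) ^ Suc i * (zigzag b (Suc (Suc i)) - zigzag b j) =
      b (Suc i) - (-1) ^ i * (zigzag b (Suc i) - zigzag b j)"
    using sq[of "b (Suc i)"] by (simp add: zigzag_def algebra_simps)
  show ?case
  proof (cases "j = Suc i")
    case True
    then show ?thesis unfolding step using pos Suc.prems by simp
  next
    case False
    then show ?thesis unfolding step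
      using Suc mono[of i "Suc i"] by fastforce
  qed
qed

text \<open>The bound on \<open>\<bar>x - y\<bar>\<close> keeps the vertices of the closed walk distinct modulo \<open>v\<close>.\<close>

definition realises :: "nat \<Rightarrow> int set \<Rightarrow> int list \<Rightarrow> bool" where
  "realises v A xs \<longleftrightarrow> distinct xs \<and> 3 \<le> length xs \<and>
     (\<forall>x\<in>set xs. \<forall>y\<in>set xs. \<bar>x - y\<bar> < int v) \<and>
     bij_betw (\<lambda>i. \<bar>xs ! i - xs ! (Suc i mod length xs)\<bar>) {..<length xs} A"

text \<open>The edge from the last position back to the start 0 has length
  \<open>\<bar>zigzag b n\<bar>\<close>; the assumption \<open>new\<close> keeps it different from
  all step lengths, so that every length occurs once. Distinctness and the diameter bound come from
  \<open>zigzag_bounds\<close>.\<close>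

lemma realises_zigzag:
  assumes pos: "\<And>i. i < n \<Longrightarrow> 0 < b i"
    and mono: "\<And>i j. i < j \<Longrightarrow> j < n \<Longrightarrow> b i < b j"
    and less: "\<And>i. i < n \<Longrightarrow> b i < int v"
    and n: "2 \<le> n" and new: "\<bar>zigzag b n\<bar> \<notin> b ` {..<n}"
  shows "realises v (insert \<bar>zigzag b n\<bar> (b ` {..<n})) (map (zigzag b) [0..<Suc n])"
proof -
  let ?xs = "map (zigzag b) [0..<Suc n]"
  have abs: "0 < \<bar>zigzag b i - zigzag b j\<bar> \<and> \<bar>zigzag b i - zigzag b j\<bar> < int v"
    if ij: "j < i" "i \<le> n" for i j
  proof -
    obtain l where l: "i = Suc l" using ij(1) by (cases i) auto
    have "\<bar>x\<bar> = \<bar>(-1) ^ l * x\<bar>" for x :: int by (simp add: abs_mult power_abs)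
    from this[of "zigzag b i - zigzag b j"] show ?thesis
      using zigzag_bounds[of n b j l, OF pos mono] less[of l] ij by (simp add: l)
  qed
  have inj: "inj_on (zigzag b) {0..n}"
  proof (rule inj_onI)
    fix i j assume "i \<in> {0..n}" "j \<in> {0..n}" "zigzag b i = zigzag b j"
    then show "i = j" using abs[of i j] abs[of j i] by (cases i j rule: linorder_cases) auto
  qed
  have 1: "distinct ?xs"
    using inj by (simp add: distinct_map atLeastLessThanSuc_atLeastAtMost del: upt_Suc)
  have 2: "\<bar>zigzag b i - zigzag b j\<bar> < int v" if "i \<le> n" "j \<le> n" for i j
    using abs[of i j] abs[of j i] that less[of 0] pos[of 0] n
    by (cases i j rule: linorder_cases) auto
  let ?D = "\<lambda>i. \<bar>?xs ! i - ?xs ! (Suc i mod length ?xs)\<bar>"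
  have D: "?D i = (if i < n then b i else \<bar>zigzag b n\<bar>)" if "i < Suc n" for i
  proof (cases "i < n")
    case True
    have "\<bar>(-1) ^ i * b i\<bar> = b i" using pos[OF True] by (simp add: abs_mult power_abs)
    then show ?thesis using True
      by (simp add: zigzag_def nth_append del: upt_Suc add: nth_upt)
  next
    case False
    then have "i = n" using that by simp
    then show ?thesis by (simp add: zigzag_def del: upt_Suc)
  qed
  have "inj_on b {..<n}"
    using mono by (auto simp: inj_on_def) (metis linorder_neqE_nat order_less_irrefl)
  then have "bij_betw (\<lambda>i. if i < n then b i else \<bar>zigzag b n\<bar>) {..<Suc n}
      (insert \<bar>zigzag b n\<bar> (b ` {..<n}))"
    using new by (force simp: bij_betw_def inj_on_def lessThan_Suc image_iff)
  then have "bij_betw ?D {..<Suc n} (insert \<bar>zigzag b n\<bar> (b ` {..<n}))"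
    using D by (subst bij_betw_cong[where g = "\<lambda>i. if i < n then b i else \<bar>zigzag b n\<bar>"]) auto
  then show ?thesis using 1 2 n unfolding realises_def
    by (auto simp del: upt_Suc)
qed

text \<open>Omit \<open>a (2 * s)\<close> and let the walk zigzag with the remaining, increasing step lengths. The
  balance condition says that it ends at distance \<open>a (2 * s)\<close> from its start, so that the omitted
  length closes it.\<close>

lemma realises_balanced:
  fixes a :: "nat \<Rightarrow> int"
  assumes pos: "\<And>i. i < 2 * p \<Longrightarrow> 0 < a i"
    and mono: "\<And>i j. i < j \<Longrightarrow> j < 2 * p \<Longrightarrow> a i < a j"
    and less: "\<And>i. i < 2 * p \<Longrightarrow> a i < int v"
    and s: "s < p" and p: "2 \<le> p"
    and bal: "(\<Sum>i<s. a (2 * i + 1) - a (2 * i)) = (\<Sum>i=s..<p. a (2 * i + 1) - a (2 * i))"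
  shows "\<exists>xs. realises v (a ` {..<2 * p}) xs"
proof -
  define n where "n = 2 * p - 1"
  have n: "Suc n = 2 * p" using p by (simp add: n_def)
  define b where "b i = (if i < 2 * s then a i else a (Suc i))" for i
  \<comment> \<open>Before the omitted entry the walk goes up by \<open>a (2 * i)\<close> and down
    by \<open>a (2 * i + 1)\<close>, so each pair loses its gap.\<close>
  have low: "zigzag b (2 * k) = - (\<Sum>i<k. a (2 * i + 1) - a (2 * i))" if "k \<le> s" for k
    using that by (induction k) (auto simp: zigzag_def b_def)
  \<comment> \<open>Omitting one entry swaps the parities: from here on odd-indexed entries of
    \<open>a\<close> are added and even-indexed ones subtracted, so each gap is gained.\<close>
  have high: "zigzag b (2 * k + 1) =
      a (2 * s) - (\<Sum>i<s. a (2 * i + 1) - a (2 * i)) + (\<Sum>i=s..<Suc k. a (2 * i + 1) - a (2 * i))"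
    if "s \<le> k" for k
    using that
  proof (induction k rule: dec_induct)
    case base
    show ?case using low[of s] by (simp add: zigzag_def b_def)
  next
    case (step k)
    have even: "(-1 :: int) ^ (k + k) = 1" by (simp flip: mult_2)
    have "zigzag b (2 * Suc k + 1) = zigzag b (2 * k + 1) - a (2 * k + 2) + a (2 * k + 3)"
      using step.hyps even by (simp add: zigzag_def b_def eval_nat_numeral)
    then show ?case using step by (simp add: eval_nat_numeral)
  qed
  have nk: "n = 2 * (p - 1) + 1" and "Suc (p - 1) = p" using p by (auto simp: n_def)
  \<comment> \<open>At the end of the walk the lost and the gained gaps cancel by
    \<open>bal\<close>.\<close>
  then have close: "zigzag b n = a (2 * s)"
    using high[of "p - 1"] s bal by (simp add: nk del: One_nat_def)
  have bpos: "0 < b i" and bless: "b i < int v" if "i < n" for i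
    using that pos less n by (auto simp: b_def)
  have bmono: "b i < b j" if "i < j" "j < n" for i j
    using that mono n by (auto simp: b_def)
  have aeq: "a i = a j \<longleftrightarrow> i = j" if "i < 2 * p" "j < 2 * p" for i j
    using that mono[of i j] mono[of j i] by (cases i j rule: linorder_cases) auto
  have img: "a ` {..<2 * p} = insert (a (2 * s)) (b ` {..<n})" (is "?L = ?R")
  proof
    show "?R \<subseteq> ?L" using s n by (auto simp: b_def)
    show "?L \<subseteq> ?R"
    proof
      fix x assume "x \<in> ?L"
      then obtain i where i: "i < 2 * p" "x = a i" by auto
      consider "i < 2 * s" | "i = 2 * s" | "2 * s < i" by linarith
      then show "x \<in> ?R"
      proof cases
        case 1
        then have "x = b i" "i < n" using i s n by (auto simp: b_def)
        then show ?thesis by auto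
      next
        case 2
        then show ?thesis using i by simp
      next
        case 3
        then have "x = b (i - 1)" "i - 1 < n" using i n by (auto simp: b_def)
        then show ?thesis by auto
      qed
    qed
  qed
  have new: "a (2 * s) \<notin> b ` {..<n}"
  proof
    assume "a (2 * s) \<in> b ` {..<n}"
    then obtain i where "i < n" "a (2 * s) = b i" by auto
    then show False using aeq[of "2 * s" i] aeq[of "2 * s" "Suc i"] s n
      by (auto simp: b_def split: if_splits)
  qed
  have "0 < a (2 * s)" using pos s by simp
  then show ?thesis
    using realises_zigzag[of n b v, OF bpos bmono bless] p n new close img by auto
qed

subsection \<open>Developing base cycles\<close>

definition shifted_cycle :: "nat \<Rightarrow> int list \<Rightarrow> int \<Rightarrow> int ugraph" where
  "shifted_cycle v xs g =
     (let ys = map (\<lambda>x. (x + g) mod int v) xs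
      in \<lparr>verts = set ys, edges = {{ys ! i, ys ! (Suc i mod length ys)} | i. i < length ys}\<rparr>)"

definition diff_edge :: "nat \<Rightarrow> int \<Rightarrow> int \<Rightarrow> int set" where
  "diff_edge v a z = {z, (z + a) mod int v}"

text \<open>Read in the opposite direction, an edge of difference \<open>a\<close> has difference
  \<open>v - a\<close>, which exceeds \<open>v / 2\<close>. Hence only one orientation of an edge
  fits the bounds, and it determines both the difference and the starting point.\<close>

lemma diff_edge_inject:
  assumes "0 < a" "2 * a < int v" "0 < b" "2 * b < int v" "z \<in> {0..<int v}" "w \<in> {0..<int v}"
    and "diff_edge v a z = diff_edge v b w"
  shows "a = b \<and> z = w"
proof -
  have m: "(y + c) mod int v = (if y + c < int v then y + c else y + c - int v)"
    if "y \<in> {0..<int v}" "0 < c" "2 * c < int v" for y c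
  proof (cases "y + c < int v")
    case False
    then have "(y + c) mod int v = (y + c - int v) mod int v" by simp
    also have "\<dots> = y + c - int v" using that False by (intro mod_pos_pos_trivial) auto
    finally show ?thesis using False by simp
  qed (use that in simp)
  show ?thesis
    using assms(7) m[of z a] m[of w b] assms(1-6)
    by (auto simp: diff_edge_def doubleton_eq_iff split: if_splits)
qed

text \<open>The point of the quantifier order is that \<open>l\<close> does not depend on
  \<open>g\<close>: every difference of the block labels one edge of the closed walk, and shifting
  the walk moves the starting point of that edge along. Over all \<open>g\<close> the edge thus runs
  once through all edges of its difference.\<close>

lemma edges_shifted_cycle:
  assumes "realises v A xs"
  shows "\<exists>l. \<forall>g. edges (shifted_cycle v xs g) = (\<lambda>a. diff_edge v a ((l a + g) mod int v)) ` A"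
proof -
  define n where "n = length xs"
  define D where "D i = \<bar>xs ! i - xs ! (Suc i mod n)\<bar>" for i
  \<comment> \<open>Starting at the smaller integer endpoint makes the difference of the edge the
    positive number \<open>D i\<close>.\<close>
  define m where "m i = min (xs ! i) (xs ! (Suc i mod n))" for i
  have bij: "bij_betw D {..<n} A" using assms by (simp add: realises_def D_def[abs_def] n_def)
  have len: "Suc i mod n < n" if "i < n" for i using that by simp
  have edge: "{(xs ! i + g) mod int v, (xs ! (Suc i mod n) + g) mod int v} =
      diff_edge v (D i) ((m i + g) mod int v)" for i g
  proof -
    have "{(x + g) mod int v, (y + g) mod int v} =
        diff_edge v \<bar>x - y\<bar> ((min x y + g) mod int v)" for x y
      unfolding diff_edge_def mod_add_left_eq
      by (cases "x \<le> y") (auto simp: algebra_simps)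
    then show ?thesis by (simp add: D_def m_def)
  qed
  define l where "l a = m (inv_into {..<n} D a)" for a
  have l: "l (D i) = m i" if "i < n" for i
    using bij that by (simp add: l_def bij_betw_def inv_into_f_f)
  have "edges (shifted_cycle v xs g) = (\<lambda>a. diff_edge v a ((l a + g) mod int v)) ` A" for g
  proof -
    have "edges (shifted_cycle v xs g) =
        {{(xs ! i + g) mod int v, (xs ! (Suc i mod n) + g) mod int v} | i. i < n}"
      unfolding shifted_cycle_def Let_def n_def[symmetric] using len
      by (auto simp: n_def[symmetric]) (metis len nth_map n_def)+
    also have "\<dots> = (\<lambda>i. diff_edge v (D i) ((l (D i) + g) mod int v)) ` {..<n}"
      using edge l by auto
    also have "\<dots> = (\<lambda>a. diff_edge v a ((l a + g) mod int v)) ` D ` {..<n}"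
      by (simp add: image_image)
    finally show ?thesis using bij by (simp add: bij_betw_def)
  qed
  then show ?thesis by blast
qed

lemma is_cycle_shifted_cycle:
  assumes "realises v A xs"
  shows "is_cycle (shifted_cycle v xs g)"
proof -
  have "inj_on (\<lambda>x. (x + g) mod int v) (set xs)"
  proof (rule inj_onI)
    fix x y assume xy: "x \<in> set xs" "y \<in> set xs" "(x + g) mod int v = (y + g) mod int v"
    then have "int v dvd x - y" by (simp add: mod_eq_dvd_iff)
    moreover have "\<bar>x - y\<bar> < int v" using assms xy by (simp add: realises_def)
    ultimately show "x = y" using zdvd_not_zless[of "\<bar>x - y\<bar>" "int v"] by fastforce
  qed
  then show ?thesis using assms unfolding is_cycle_def shifted_cycle_def realises_def
    by (intro exI[of _ "map (\<lambda>x. (x + g) mod int v) xs"]) (simp add: Let_def distinct_map)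
qed

lemma translate_shifted_cycle:
  assumes "0 < length xs"
  shows "translate (integer_mod_group v) g' (shifted_cycle v xs g) =
    shifted_cycle v xs ((g + g') mod int v)"
proof -
  let ?t = "\<lambda>y. (y + g') mod int v"
  let ?ys = "map (\<lambda>x. (x + g) mod int v) xs"
  have eq: "map ?t ?ys = map (\<lambda>x. (x + (g + g') mod int v) mod int v) xs"
    by (simp add: o_def mod_add_left_eq mod_add_right_eq add.assoc)
  have len: "Suc i mod length xs < length xs" for i using assms by simp
  have "(`) ?t ` {{?ys ! i, ?ys ! (Suc i mod length ?ys)} | i. i < length ?ys} =
      {{map ?t ?ys ! i, map ?t ?ys ! (Suc i mod length (map ?t ?ys))} | i. i < length (map ?t ?ys)}"
    (is "?L = ?R")
  proof -
    have "?L = {?t ` {?ys ! i, ?ys ! (Suc i mod length ?ys)} | i. i < length ?ys}" by blast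
    also have "\<dots> = ?R"
    proof -
      have "?t ` {?ys ! i, ?ys ! (Suc i mod length ?ys)} =
          {map ?t ?ys ! i, map ?t ?ys ! (Suc i mod length (map ?t ?ys))}" if "i < length ?ys" for i
        using that len by (simp del: map_map)
      then show ?thesis by (metis (no_types, lifting) length_map)
    qed
    finally show ?thesis .
  qed
  moreover have "?t ` set ?ys = set (map ?t ?ys)" by (simp only: set_map)
  ultimately show ?thesis
    unfolding translate_def shifted_cycle_def Let_def eq[symmetric] by simp
qed

text \<open>This is the Cayley graph on the integers modulo \<open>v\<close> whose connection set
  consists of \<open>H\<close> and its negatives. The bound \<open>2 * a < int v\<close> leaves one
  representative of each pair and excludes the involution.\<close>

locale difference_graph =
  fixes v :: nat and H :: "int set" and K :: "int ugraph"
  assumes modulus_pos: "0 < v"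
    and difference_bounds: "\<And>a. a \<in> H \<Longrightarrow> 0 < a \<and> 2 * a < int v"
    and verts_K: "verts K = {0..<int v}"
    and edges_K: "edges K = (\<Union>a\<in>H. diff_edge v a ` {0..<int v})"
begin

text \<open>Known in design theory as a difference family of cycles: up to sign, each difference in
  \<open>H\<close> occurs on exactly one edge of exactly one base cycle.\<close>

definition base_family :: "'b set \<Rightarrow> ('b \<Rightarrow> int set) \<Rightarrow> ('b \<Rightarrow> int list) \<Rightarrow> bool" where
  "base_family B A xs \<longleftrightarrow> finite B \<and> (\<forall>b\<in>B. realises v (A b) (xs b)) \<and>
     disjoint_family_on A B \<and> (\<Union>b\<in>B. A b) = H"

definition develop :: "'b set \<Rightarrow> ('b \<Rightarrow> int list) \<Rightarrow> int ugraph set" where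
  "develop B xs = (\<lambda>(b, g). shifted_cycle v (xs b) g) ` (B \<times> {0..<int v})"

text \<open>Starting points are fixed once per base cycle, so that all its translates refer to the
  same ones.\<close>

definition base_points :: "('b \<Rightarrow> int set) \<Rightarrow> ('b \<Rightarrow> int list) \<Rightarrow> 'b \<Rightarrow> int \<Rightarrow> int" where
  "base_points A xs b = (SOME l. \<forall>g. edges (shifted_cycle v (xs b) g) =
     (\<lambda>a. diff_edge v a ((l a + g) mod int v)) ` A b)"

lemma edges_base:
  assumes "base_family B A xs" "b \<in> B"
  shows "edges (shifted_cycle v (xs b) g) =
    (\<lambda>a. diff_edge v a ((base_points A xs b a + g) mod int v)) ` A b"
proof -
  have "realises v (A b) (xs b)" using assms by (simp add: base_family_def)
  from someI_ex[OF edges_shifted_cycle[OF this]] show ?thesis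
    unfolding base_points_def by (rule spec)
qed

lemma in_H: "base_family B A xs \<Longrightarrow> b \<in> B \<Longrightarrow> a \<in> A b \<Longrightarrow> a \<in> H"
  by (auto simp: base_family_def)

lemma mod_range: "x mod int v \<in> {0..<int v}"
  using modulus_pos by simp

lemma edge_eqD:
  assumes "diff_edge v a (x mod int v) = diff_edge v b (y mod int v)" "a \<in> H" "b \<in> H"
  shows "a = b \<and> x mod int v = y mod int v"
  using diff_edge_inject[OF _ _ _ _ mod_range mod_range assms(1)] difference_bounds assms(2,3) by blast

lemma card_edges:
  assumes "base_family B A xs" "b \<in> B"
  shows "card (edges (shifted_cycle v (xs b) g)) = card (A b)"
  unfolding edges_base[OF assms]
proof (rule card_image, rule inj_onI)
  fix a a' assume "a \<in> A b" "a' \<in> A b"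
    "diff_edge v a ((base_points A xs b a + g) mod int v) =
     diff_edge v a' ((base_points A xs b a' + g) mod int v)"
  then show "a = a'" using edge_eqD in_H[OF assms] by metis
qed

lemma nonempty_base:
  assumes "base_family B A xs" "b \<in> B"
  shows "A b \<noteq> {}" and "0 < length (xs b)"
proof -
  have "realises v (A b) (xs b)" using assms by (simp add: base_family_def)
  then show "0 < length (xs b)" and "A b \<noteq> {}"
    by (auto simp: realises_def bij_betw_def lessThan_empty_iff)
qed

text \<open>The difference of an edge determines the base cycle, because the blocks are disjoint;
  its starting point then determines the shift. Both edge-disjointness and injectivity of the
  development rest on this.\<close>

lemma common_edge:
  assumes "base_family B A xs" "b \<in> B" "b' \<in> B" "g \<in> {0..<int v}" "g' \<in> {0..<int v}"
    and "e \<in> edges (shifted_cycle v (xs b) g)" "e \<in> edges (shifted_cycle v (xs b') g')"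
  shows "b = b' \<and> g = g'"
proof -
  obtain a where a: "a \<in> A b" "e = diff_edge v a ((base_points A xs b a + g) mod int v)"
    using assms(6) edges_base[OF assms(1,2)] by auto
  obtain a' where a': "a' \<in> A b'" "e = diff_edge v a' ((base_points A xs b' a' + g') mod int v)"
    using assms(7) edges_base[OF assms(1,3)] by auto
  have e: "a = a'" "(base_points A xs b a + g) mod int v = (base_points A xs b' a' + g') mod int v"
    using edge_eqD[of a _ a'] a a' in_H[OF assms(1)] assms(2,3) by metis+
  then have b: "b = b'"
    using assms(1-3) a a' unfolding base_family_def disjoint_family_on_def by blast
  have "(base_points A xs b a + g) mod int v = (base_points A xs b a + g') mod int v"
    using e b by simp
  then have "g mod int v = g' mod int v" by (simp add: mod_eq_dvd_iff)
  then show ?thesis using b assms(4,5) by simp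
qed

text \<open>Each base cycle has \<open>v\<close> different translates and different base cycles
  share none; this is what makes the count of cycle lengths exact.\<close>

lemma inj_develop:
  assumes "base_family B A xs"
  shows "inj_on (\<lambda>(b, g). shifted_cycle v (xs b) g) (B \<times> {0..<int v})"
proof (rule inj_onI, clarify)
  fix b g b' g'
  assume *: "b \<in> B" "b' \<in> B" "g \<in> {0..<int v}" "g' \<in> {0..<int v}"
    "shifted_cycle v (xs b) g = shifted_cycle v (xs b') g'"
  obtain e where "e \<in> edges (shifted_cycle v (xs b) g)"
    using edges_base[OF assms *(1)] nonempty_base(1)[OF assms *(1)] by blast
  then show "b = b' \<and> g = g'" using common_edge[OF assms *(1-4)] *(5) by simp
qed

lemma decomposition_develop:
  assumes "base_family B A xs"
  shows "cycle_decomposition K (develop B xs)"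
  unfolding cycle_decomposition_def
proof (intro conjI ballI)
  fix C assume "C \<in> develop B xs"
  then obtain b g where C: "b \<in> B" "C = shifted_cycle v (xs b) g" by (auto simp: develop_def)
  have "realises v (A b) (xs b)" using assms C(1) by (simp add: base_family_def)
  then show "is_cycle C" using is_cycle_shifted_cycle C(2) by blast
  have "verts C \<subseteq> verts K" using mod_range by (auto simp: C(2) shifted_cycle_def Let_def verts_K)
  moreover have "edges C \<subseteq> edges K"
    unfolding C(2) edges_base[OF assms C(1)] edges_K using in_H[OF assms C(1)] mod_range by blast
  ultimately show "subgraph_of C K" by (simp add: subgraph_of_def)
next
  show "disjoint_family_on edges (develop B xs)"
    unfolding disjoint_family_on_def develop_def using common_edge[OF assms] by fastforce
next
  show "(\<Union>C\<in>develop B xs. edges C) = edges K"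
  proof
    show "(\<Union>C\<in>develop B xs. edges C) \<subseteq> edges K"
      unfolding develop_def edges_K using edges_base[OF assms] in_H[OF assms] mod_range by fastforce
    show "edges K \<subseteq> (\<Union>C\<in>develop B xs. edges C)"
    proof
      fix e assume "e \<in> edges K"
      then obtain a z where e: "a \<in> H" "z \<in> {0..<int v}" "e = diff_edge v a z"
        by (auto simp: edges_K)
      obtain b where b: "b \<in> B" "a \<in> A b" using assms e(1) by (auto simp: base_family_def)
      \<comment> \<open>The only shift that moves the edge of difference \<open>a\<close> in base
        cycle \<open>b\<close> to the starting point \<open>z\<close>.\<close>
      define g where "g = (z - base_points A xs b a) mod int v"
      have "(base_points A xs b a + g) mod int v = z"
        using e(2) by (simp add: g_def mod_add_right_eq)
      then have "e \<in> edges (shifted_cycle v (xs b) g)"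
        unfolding edges_base[OF assms b(1)] using b(2) e(3) by force
      moreover have "g \<in> {0..<int v}" using mod_range by (simp add: g_def)
      ultimately show "e \<in> (\<Union>C\<in>develop B xs. edges C)" using b(1) by (force simp: develop_def)
    qed
  qed
qed

lemma regular_develop:
  assumes "base_family B A xs"
  shows "regular_under (integer_mod_group v) (develop B xs)"
  unfolding regular_under_def
proof
  fix g' assume "g' \<in> carrier (integer_mod_group v)"
  have tr: "translate (integer_mod_group v) g' (shifted_cycle v (xs b) g) =
      shifted_cycle v (xs b) ((g + g') mod int v)" if "b \<in> B" for b g
    using translate_shifted_cycle nonempty_base(2)[OF assms that] by blast
  show "translate (integer_mod_group v) g' ` develop B xs = develop B xs"
  proof
    show "translate (integer_mod_group v) g' ` develop B xs \<subseteq> develop B xs"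
      using tr mod_range by (fastforce simp: develop_def)
    show "develop B xs \<subseteq> translate (integer_mod_group v) g' ` develop B xs"
    proof
      fix C assume "C \<in> develop B xs"
      then obtain b g where C: "b \<in> B" "g \<in> {0..<int v}" "C = shifted_cycle v (xs b) g"
        by (auto simp: develop_def)
      have "C = translate (integer_mod_group v) g' (shifted_cycle v (xs b) ((g - g') mod int v))"
        using C(2,3) by (simp add: tr[OF C(1)] mod_add_left_eq)
      then show "C \<in> translate (integer_mod_group v) g' ` develop B xs"
        using C(1) mod_range by (force simp: develop_def)
    qed
  qed
qed

lemma cycle_lengths_develop:
  assumes "base_family B A xs"
  shows "cycle_lengths (develop B xs) = repeat_mset v (image_mset (\<lambda>b. card (A b)) (mset_set B))"
proof -
  have fin: "finite B" using assms by (simp add: base_family_def)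
  have "cycle_lengths (develop B xs) =
      image_mset (\<lambda>(b, g). cycle_length (shifted_cycle v (xs b) g)) (mset_set (B \<times> {0..<int v}))"
    unfolding cycle_lengths_def develop_def
    by (subst image_mset_mset_set[OF inj_develop[OF assms], symmetric])
      (simp add: multiset.map_comp o_def case_prod_unfold)
  also have "\<dots> = image_mset (\<lambda>(b, g). card (A b)) (mset_set (B \<times> {0..<int v}))"
    using fin by (intro image_mset_cong) (auto simp: cycle_length_def card_edges[OF assms])
  also have "\<dots> = repeat_mset v (image_mset (\<lambda>b. card (A b)) (mset_set B))"
    using fin
  proof (induction B rule: finite_induct)
    case (insert b B)
    have *: "insert b B \<times> {0..<int v} = ({b} \<times> {0..<int v}) \<union> (B \<times> {0..<int v})" by auto
    have "mset_set (insert b B \<times> {0..<int v}) =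
        mset_set ({b} \<times> {0..<int v}) + mset_set (B \<times> {0..<int v})"
      unfolding * using insert.hyps by (intro mset_set_Union) auto
    moreover have "image_mset (\<lambda>(b, g). card (A b)) (mset_set ({b} \<times> {0..<int v})) =
        image_mset (\<lambda>_. card (A b)) (mset_set ({b} \<times> {0..<int v}))"
      by (intro image_mset_cong) auto
    moreover have "\<dots> = repeat_mset v {#card (A b)#}"
      by (simp add: image_mset_const_eq card_cartesian_product_singleton
        repeat_mset_replicate_mset)
    ultimately show ?case using insert by simp
  qed simp
  finally show ?thesis .
qed

text \<open>A common edge of two cycles has a difference lying in both blocks, and within one
  translate a difference determines its edge. So there are at most as many common edges as common
  differences.\<close>

lemma orthogonal_develop:
  assumes f: "base_family B A xs" "base_family B' A' xs'"
    and "\<And>b b'. b \<in> B \<Longrightarrow> b' \<in> B' \<Longrightarrow> card (A b \<inter> A' b') \<le> 1"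
  shows "orthogonal_decompositions (develop B xs) (develop B' xs')"
  unfolding orthogonal_decompositions_def
proof (intro ballI)
  fix F F' assume "F \<in> develop B xs" "F' \<in> develop B' xs'"
  then obtain b g b' g' where F: "b \<in> B" "F = shifted_cycle v (xs b) g"
    "b' \<in> B'" "F' = shifted_cycle v (xs' b') g'" by (auto simp: develop_def)
  have "edges F \<inter> edges F' \<subseteq>
      (\<lambda>a. diff_edge v a ((base_points A xs b a + g) mod int v)) ` (A b \<inter> A' b')"
  proof
    fix e assume "e \<in> edges F \<inter> edges F'"
    then obtain a a' where a: "a \<in> A b" "e = diff_edge v a ((base_points A xs b a + g) mod int v)"
      and a': "a' \<in> A' b'" "e = diff_edge v a' ((base_points A' xs' b' a' + g') mod int v)"
      unfolding F(2,4) edges_base[OF f(1) F(1)] edges_base[OF f(2) F(3)] by blast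
    then have "a = a'" using edge_eqD in_H[OF f(1) F(1)] in_H[OF f(2) F(3)] by metis
    then show "e \<in> (\<lambda>a. diff_edge v a ((base_points A xs b a + g) mod int v)) ` (A b \<inter> A' b')"
      using a a'(1) by blast
  qed
  moreover have "finite (A b)"
    using f(1) F(1) bij_betw_finite by (fastforce simp: base_family_def realises_def)
  ultimately have "card (edges F \<inter> edges F') \<le> card (A b \<inter> A' b')"
    by (meson surj_card_le finite_Int)
  then show "card (edges F \<inter> edges F') \<le> 1" using assms(3)[OF F(1,3)] by simp
qed

end

subsection \<open>The difference set of the equipartite graph\<close>

text \<open>By Lagrange, \<open>u * x\<close> vanishes modulo \<open>v = q * u\<close> for every
  \<open>x\<close> in \<open>U\<close>, so \<open>q\<close> divides \<open>x\<close>. There are only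
  \<open>u\<close> such residues, hence equality.\<close>

lemma subgroup_integer_mod_group_eq_multiples:
  fixes q u v :: nat
  assumes v: "v = q * u" "0 < q" "0 < u"
    and U: "subgroup U (integer_mod_group v)" "card U = u"
  shows "U = {x \<in> {0..<int v}. int q dvd x}"
proof (rule card_subset_eq)
  interpret G: group "integer_mod_group v" by simp
  interpret S: subgroup U "integer_mod_group v" by (rule U(1))
  let ?S = "(integer_mod_group v)\<lparr>carrier := U\<rparr>"
  interpret GU: group ?S using S.subgroup_is_group[OF G.is_group] .
  have v0: "v \<noteq> 0" using v by simp
  show "finite {x \<in> {0..<int v}. int q dvd x}"
    by (rule finite_subset[of _ "{0..<int v}"]) auto
  show "U \<subseteq> {x \<in> {0..<int v}. int q dvd x}"
  proof
    fix x assume x: "x \<in> U"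
    then have "x [^]\<^bsub>?S\<^esub> order ?S = \<one>\<^bsub>?S\<^esub>" by (intro GU.pow_order_eq_1) auto
    then have "(int u * x) mod int v = 0"
      by (simp add: order_def U(2) flip: G.nat_pow_consistent)
    then have "int u * int q dvd int u * x" by (simp add: v(1) mod_eq_0_iff_dvd mult.commute)
    then have "int q dvd x" using v(3) by simp
    then show "x \<in> {x \<in> {0..<int v}. int q dvd x}"
      using x S.subset v0 by (auto simp: carrier_integer_mod_group)
  qed
  have "{x \<in> {0..<int v}. int q dvd x} = (\<lambda>i. int q * i) ` {0..<int u}"
    using v by (auto elim!: dvdE simp: zero_le_mult_iff)
  also have "card \<dots> = u" using v(2) by (simp add: card_image inj_on_def)
  finally show "card U = card {x \<in> {0..<int v}. int q dvd x}" using U(2) by simp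
qed

text \<open>An edge whose difference exceeds \<open>v / 2\<close> is read backwards. A difference
  equal to \<open>v / 2\<close> does not occur: the odd number \<open>q\<close> divides
  \<open>v\<close>, so it would divide that difference as well.\<close>

lemma difference_graph_cayley_complement:
  fixes q u v :: nat
  assumes v: "v = q * u" "odd q" "0 < u"
    and U: "subgroup U (integer_mod_group v)" "card U = u"
  shows "difference_graph v {a. 0 < a \<and> 2 * a < int v \<and> \<not> int q dvd a}
    (cayley_complement (integer_mod_group v) U)"
proof
  have q: "0 < q" using v(2) by (rule odd_pos)
  show v0: "0 < v" using v q by simp
  let ?H = "{a. 0 < a \<and> 2 * a < int v \<and> \<not> int q dvd a}"
  have carr: "carrier (integer_mod_group v) = {0..<int v}"
    using v0 by (simp add: carrier_integer_mod_group)
  show "verts (cayley_complement (integer_mod_group v) U) = {0..<int v}"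
    by (simp add: cayley_complement_def carr)
  have qv: "int q dvd int v" by (simp add: v(1))
  have U_eq: "U = {x \<in> {0..<int v}. int q dvd x}"
    using subgroup_integer_mod_group_eq_multiples[OF v(1) q v(3) U] .
  have "x \<otimes>\<^bsub>integer_mod_group v\<^esub> inv\<^bsub>integer_mod_group v\<^esub> y \<in> U \<longleftrightarrow> int q dvd x - y"
    if "y \<in> {0..<int v}" for x y
  proof -
    have "x \<otimes>\<^bsub>integer_mod_group v\<^esub> inv\<^bsub>integer_mod_group v\<^esub> y = (x - y) mod int v"
      using that by (simp add: carr mod_add_right_eq)
    then show ?thesis using v0 qv by (simp add: U_eq dvd_mod_iff)
  qed
  then have edges: "edges (cayley_complement (integer_mod_group v) U) =
      {{x, y} | x y. x \<in> {0..<int v} \<and> y \<in> {0..<int v} \<and> \<not> int q dvd x - y}"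
    unfolding cayley_complement_def carr by auto
  have aux: "\<exists>a\<in>?H. {x, y} \<in> diff_edge v a ` {0..<int v}"
    if xy: "x \<in> {0..<int v}" "y \<in> {0..<int v}" "\<not> int q dvd x - y" "y < x" for x y
  proof (cases "2 * (x - y) < int v")
    case True
    then have "x - y \<in> ?H" "{x, y} = diff_edge v (x - y) y"
      using xy by (auto simp: diff_edge_def)
    then show ?thesis using xy(2) by blast
  next
    case False
    have "2 * (x - y) \<noteq> int v"
    proof
      assume "2 * (x - y) = int v"
      then have "int q dvd 2 * (x - y)" using qv by simp
      moreover have "coprime (int q) 2" using v(2) by simp
      ultimately show False using xy(3) by (metis coprime_dvd_mult_right_iff)
    qed
    moreover have "\<not> int q dvd int v - (x - y)" using qv xy(3) by (simp add: dvd_diff_right_iff)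
    moreover have "(x + (int v - (x - y))) mod int v = y" using xy by simp
    ultimately have "int v - (x - y) \<in> ?H" "{x, y} = diff_edge v (int v - (x - y)) x"
      using False xy by (auto simp: diff_edge_def)
    then show ?thesis using xy(1) by blast
  qed
  show "edges (cayley_complement (integer_mod_group v) U) =
      (\<Union>a\<in>?H. diff_edge v a ` {0..<int v})" (is "?L = ?R")
  proof
    show "?R \<subseteq> ?L"
    proof
      fix e assume "e \<in> ?R"
      then obtain a z where a: "a \<in> ?H" "z \<in> {0..<int v}" "e = diff_edge v a z" by auto
      have "(z + a) mod int v - z = a - int v * ((z + a) div int v)"
        by (simp flip: minus_mult_div_eq_mod)
      then have "\<not> int q dvd (z + a) mod int v - z"
        using a(1) qv by (simp add: dvd_diff_left_iff)
      moreover have "(z + a) mod int v \<in> {0..<int v}" using v0 by simp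
      moreover have "e = {(z + a) mod int v, z}" using a(3) by (simp add: diff_edge_def insert_commute)
      ultimately show "e \<in> ?L" using a(2) unfolding edges by blast
    qed
    show "?L \<subseteq> ?R"
    proof
      fix e assume "e \<in> ?L"
      then obtain x y where e: "e = {x, y}" "x \<in> {0..<int v}" "y \<in> {0..<int v}"
        "\<not> int q dvd x - y" by (auto simp: edges)
      then have "x \<noteq> y" "\<not> int q dvd y - x" by (auto simp: dvd_diff_commute)
      then show "e \<in> ?R" using aux[of x y] aux[of y x] e
        by (cases "y < x") (auto simp: insert_commute)
    qed
  qed
qed auto

text \<open>For \<open>0 < d\<close> this enumerates, from \<open>t = 0\<close> on, the positive integers not divisible by
  \<open>2 * d + 1\<close>.\<close>

definition nonmultiple :: "nat \<Rightarrow> nat \<Rightarrow> int" where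
  "nonmultiple d t = int (t + 1 + t div (2 * d))"

lemma nonmultiple_strict_mono: "s < t \<Longrightarrow> nonmultiple d s < nonmultiple d t"
  using div_le_mono[of s t "2 * d"] by (simp add: nonmultiple_def)

text \<open>As \<open>2 * d\<close> is even, the indices \<open>2 * i\<close> and
  \<open>2 * i + 1\<close> have the same quotient by it. These pairs of consecutive integers balance
  the row cycles.\<close>

lemma nonmultiple_odd: "nonmultiple d (2 * i + 1) = nonmultiple d (2 * i) + 1"
  by (simp add: nonmultiple_def div_mult2_eq)

lemma nonmultiple_pos: "0 < nonmultiple d t"
  by (simp add: nonmultiple_def)

text \<open>The index \<open>2 * d * j + s\<close> with \<open>s < 2 * d\<close> corresponds to
  \<open>(2 * d + 1) * j + s + 1\<close>, the entry number \<open>s\<close> between two successive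
  multiples of \<open>2 * d + 1\<close>.\<close>

lemma nonmultiple_range:
  assumes "0 < d"
  shows "nonmultiple d ` {..<2 * d * l} =
    {a. 0 < a \<and> a < int ((2 * d + 1) * l) \<and> \<not> int (2 * d + 1) dvd a}" (is "?L = ?R")
proof
  let ?q = "int (2 * d + 1)"
  show "?L \<subseteq> ?R"
  proof
    fix a assume "a \<in> ?L"
    then obtain t where t: "t < 2 * d * l" "a = nonmultiple d t" by auto
    define j s where "j = t div (2 * d)" and "s = t mod (2 * d)"
    have s: "s < 2 * d" using assms by (simp add: s_def)
    have ts: "t = 2 * d * j + s" by (simp add: j_def s_def)
    have j: "j < l" using t(1) assms by (simp add: j_def less_mult_imp_div_less mult.commute)
    have a: "a = ?q * int j + int (s + 1)"
      using t(2) by (simp add: nonmultiple_def flip: j_def) (simp add: ts algebra_simps)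
    have "\<not> ?q dvd int (s + 1)" using s by (intro zdvd_not_zless) auto
    then have "\<not> ?q dvd a" by (simp add: a dvd_add_right_iff)
    moreover have "(2 * d + 1) * (j + 1) \<le> (2 * d + 1) * l"
      using j by (intro mult_le_mono2) simp
    then have "?q * int j + ?q \<le> int ((2 * d + 1) * l)"
      by (metis (mono_tags) distrib_left mult.right_neutral of_nat_1 of_nat_add of_nat_le_iff of_nat_mult)
    then have "a < int ((2 * d + 1) * l)" using s a by linarith
    moreover have "0 < a" using t(2) nonmultiple_pos by simp
    ultimately show "a \<in> ?R" by simp
  qed
  show "?R \<subseteq> ?L"
  proof
    fix a assume a: "a \<in> ?R"
    define n where "n = nat a"
    have n: "a = int n" "n < (2 * d + 1) * l" "\<not> 2 * d + 1 dvd n"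
      using a by (auto simp: n_def nat_less_iff simp flip: int_dvd_int_iff)
    define j s where "j = n div (2 * d + 1)" and "s = n mod (2 * d + 1)"
    have nj: "n = (2 * d + 1) * j + s" unfolding j_def s_def by (rule mult_div_mod_eq[symmetric])
    have s: "0 < s" "s < 2 * d + 1" using n(3) by (auto simp: s_def mod_greater_zero_iff_not_dvd)
    have j: "j < l" using n(2) by (simp add: j_def less_mult_imp_div_less mult.commute)
    define t where "t = 2 * d * j + (s - 1)"
    have "s - 1 < 2 * d" using s by linarith
    then have "t div (2 * d) = j" unfolding t_def by simp
    then have "nonmultiple d t = a" using s by (simp add: nonmultiple_def n(1) nj t_def)
    moreover have "2 * d * (j + 1) \<le> 2 * d * l" using j by (intro mult_le_mono2) simp
    then have "t < 2 * d * l" using s by (simp add: t_def)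
    ultimately show "a \<in> ?L" by blast
  qed
qed

text \<open>The bound \<open>e t \<le> \<delta>\<close> separates the two halves of the difference
  set. It is not strict because for \<open>u = 1\<close> the lower half ends at
  \<open>\<delta>\<close> itself.\<close>

lemma half_set_split:
  fixes d u v :: nat
  assumes "0 < d" "0 < u" "v = (2 * d + 1) * u" "[v = u] (mod 16)" "u = 1 \<or> [u = 0] (mod 4)"
  defines "e \<equiv> nonmultiple d"
  shows "\<exists>\<delta>. (\<forall>t < d * u div 2. e t \<le> \<delta>) \<and>
    {a. 0 < a \<and> 2 * a < int v \<and> \<not> int (2 * d + 1) dvd a} =
      e ` {..<d * u div 2} \<union> (\<lambda>t. e t + \<delta>) ` {..<d * u div 2}"
  using assms(5)
proof
  assume u: "u = 1"
  \<comment> \<open>Here \<open>v - u = 2 * d\<close>, so the congruence modulo 16 applies to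
    \<open>2 * d\<close>; evenness of \<open>d\<close> is then used to halve the interval.\<close>
  have "8 dvd d" 
    using assms(3,4) u by (simp add: cong_def) presburger
  then have d: "2 * (d div 2) = d" by auto
  have e: "e t = int t + 1" if "t < d" for t using that by (simp add: e_def nonmultiple_def)
  have *: "{a. 0 < a \<and> 2 * a < int v \<and> \<not> int (2 * d + 1) dvd a} = {1..int d}"
    using assms(3) u zdvd_not_zless[of _ "int (2 * d + 1)"] by auto
  have **: "e ` {..<d div 2} = {1..int (d div 2)}"
  proof -
    have "e ` {..<d div 2} = (\<lambda>t. int t + 1) ` {..<d div 2}"
      by (rule image_cong) (use e in auto)
    also have "\<dots> = {1..int (d div 2)}"
    proof (intro equalityI subsetI)
      fix x assume "x \<in> {1..int (d div 2)}"
      then have "x = int (nat (x - 1)) + 1" "nat (x - 1) < d div 2" by auto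
      then show "x \<in> (\<lambda>t. int t + 1) ` {..<d div 2}" by blast
    qed auto
    finally show ?thesis .
  qed
  have "(\<lambda>t. e t + int (d div 2)) ` {..<d div 2} = (\<lambda>x. x + int (d div 2)) ` {1..int (d div 2)}"
    unfolding **[symmetric] by (simp add: image_image)
  also have "\<dots> = {int (d div 2) + 1..int d}"
    using d by (simp add: image_add_atLeastAtMost')
  finally have "e ` {..<d div 2} \<union> (\<lambda>t. e t + int (d div 2)) ` {..<d div 2} = {1..int d}"
    unfolding ** by auto
  then show ?thesis unfolding * using e u by (intro exI[of _ "int (d div 2)"]) auto
next
  assume "[u = 0] (mod 4)"
  then obtain l where u: "u = 4 * l" by (auto simp: cong_0_iff elim: dvdE)
  define \<delta> where "\<delta> = int ((2 * d + 1) * l)"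
  have T: "d * u div 2 = 2 * d * l" by (simp add: u)
  have v: "int v = 4 * \<delta>" by (simp add: assms(3) u \<delta>_def algebra_simps)
  \<comment> \<open>Since \<open>2 * d + 1\<close> divides \<open>\<delta>\<close>, shifting by
    \<open>\<delta>\<close> preserves non-divisibility, and the boundary point
    \<open>\<delta>\<close> lies in neither half.\<close>
  have q: "int (2 * d + 1) dvd \<delta>" unfolding \<delta>_def of_nat_mult by (rule dvd_triv_left)
  have rng: "e ` {..<2 * d * l} = {a. 0 < a \<and> a < \<delta> \<and> \<not> int (2 * d + 1) dvd a}"
    unfolding e_def \<delta>_def by (rule nonmultiple_range[OF assms(1)])
  have shift: "(\<lambda>t. e t + \<delta>) ` {..<2 * d * l} = (\<lambda>a. a + \<delta>) ` (e ` {..<2 * d * l})"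
    by (simp add: image_image)
  have "{a. 0 < a \<and> 2 * a < int v \<and> \<not> int (2 * d + 1) dvd a} =
      e ` {..<2 * d * l} \<union> (\<lambda>t. e t + \<delta>) ` {..<2 * d * l}" (is "?L = ?R")
  proof
    show "?R \<subseteq> ?L" unfolding shift unfolding rng using q v by (auto simp: dvd_add_left_iff)
    show "?L \<subseteq> ?R"
    proof
      fix a assume a: "a \<in> ?L"
      show "a \<in> ?R"
      proof (cases "a < \<delta>")
        case True
        then show ?thesis unfolding rng using a by simp
      next
        case False
        then have "a \<noteq> \<delta>" using a q by auto
        moreover have "\<not> int (2 * d + 1) dvd a - \<delta>" using a q by (simp add: dvd_diff_left_iff)
        ultimately have "a - \<delta> \<in> e ` {..<2 * d * l}" unfolding rng using a v False by simp
        then have "a - \<delta> + \<delta> \<in> (\<lambda>t. e t + \<delta>) ` {..<2 * d * l}" unfolding shift by blast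
        then show ?thesis by simp
      qed
    qed
  qed
  moreover have "e t \<le> \<delta>" if "t < 2 * d * l" for t
  proof -
    have "e t \<in> e ` {..<2 * d * l}" using that by simp
    then show ?thesis unfolding rng by simp
  qed
  ultimately show ?thesis unfolding T by blast
qed

subsection \<open>Base cycles from the rows and columns of a matrix\<close>

text \<open>Number the ones of the matrix row by row; \<open>\<kappa> t\<close> is the column of the
  one with number \<open>t\<close>. Row \<open>i\<close> owns an interval of numbers, and
  injectivity there says that a row meets a column at most once.\<close>

lemma row_column_labelling:
  fixes M :: "nat \<Rightarrow> nat \<Rightarrow> bool" and r :: "nat \<Rightarrow> nat"
  assumes "\<And>i. i < p \<Longrightarrow> card {j. j < N \<and> M i j} = r i"
  shows "\<exists>\<kappa>. (\<forall>t<\<Sum>i<p. r i. \<kappa> t < N) \<and>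
    (\<forall>j<N. card {t. t < (\<Sum>i<p. r i) \<and> \<kappa> t = j} = card {i\<in>{..<p}. M i j}) \<and>
    (\<forall>i<p. inj_on \<kappa> {\<Sum>l<i. r l..<\<Sum>l<Suc i. r l})"
  using assms
proof (induction p)
  case 0
  show ?case by auto
next
  case (Suc p)
  define T where "T = (\<Sum>i<p. r i)"
  have T': "(\<Sum>i<Suc p. r i) = T + r p" by (simp add: T_def)
  have "card {j. j < N \<and> M i j} = r i" if "i < p" for i using Suc.prems that by simp
  from Suc.IH[OF this] obtain \<kappa> where \<kappa>: "\<And>t. t < T \<Longrightarrow> \<kappa> t < N"
    "\<And>j. j < N \<Longrightarrow> card {t. t < T \<and> \<kappa> t = j} = card {i\<in>{..<p}. M i j}"
    "\<And>i. i < p \<Longrightarrow> inj_on \<kappa> {\<Sum>l<i. r l..<\<Sum>l<Suc i. r l}"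
    unfolding T_def by blast
  \<comment> \<open>The ones of the new row \<open>p\<close> may be numbered by any bijection from
    the new interval.\<close>
  have "card {T..<T + r p} = card {j. j < N \<and> M p j}" using Suc.prems by simp
  then obtain f where f: "bij_betw f {T..<T + r p} {j. j < N \<and> M p j}"
    by (metis finite_atLeastLessThan finite_Collect_conjI finite_Collect_less_nat
        finite_same_card_bij)
  define \<kappa>' where "\<kappa>' t = (if t < T then \<kappa> t else f t)" for t
  have f_in: "f t < N \<and> M p (f t)" if "T \<le> t" "t < T + r p" for t
    using f that by (auto simp: bij_betw_def)
  have "\<kappa>' t < N" if "t < T + r p" for t
    using \<kappa>(1) f_in that by (simp add: \<kappa>'_def)
  moreover have "card {t. t < T + r p \<and> \<kappa>' t = j} = card {i\<in>{..<Suc p}. M i j}"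
    if j: "j < N" for j
  proof -
    have "{t. t < T + r p \<and> \<kappa>' t = j} =
        {t. t < T \<and> \<kappa> t = j} \<union> {t \<in> {T..<T + r p}. f t = j}"
      by (auto simp: \<kappa>'_def)
    moreover have "card ({t. t < T \<and> \<kappa> t = j} \<union> {t \<in> {T..<T + r p}. f t = j}) =
        card {t. t < T \<and> \<kappa> t = j} + card {t \<in> {T..<T + r p}. f t = j}"
      by (rule card_Un_disjoint) auto
    ultimately have 1: "card {t. t < T + r p \<and> \<kappa>' t = j} =
        card {i\<in>{..<p}. M i j} + card {t \<in> {T..<T + r p}. f t = j}"
      using \<kappa>(2)[OF j] by simp
    show ?thesis
    proof (cases "M p j")
      case True
      then have "j \<in> f ` {T..<T + r p}" using f j by (simp add: bij_betw_def)
      then obtain t where t: "t \<in> {T..<T + r p}" "f t = j" by blast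
      then have "{t \<in> {T..<T + r p}. f t = j} = {t}"
        using f by (auto simp: bij_betw_def inj_on_def)
      moreover have "{i\<in>{..<Suc p}. M i j} = insert p {i\<in>{..<p}. M i j}"
        using True by auto
      ultimately show ?thesis using 1 by simp
    next
      case False
      then have "{t \<in> {T..<T + r p}. f t = j} = {}" using f_in by auto
      moreover have "{i\<in>{..<Suc p}. M i j} = {i\<in>{..<p}. M i j}"
        using False less_Suc_eq by auto
      ultimately show ?thesis using 1 by simp
    qed
  qed
  moreover have "inj_on \<kappa>' {\<Sum>l<i. r l..<\<Sum>l<Suc i. r l}" if "i < Suc p" for i
  proof (cases "i = p")
    case True
    have "inj_on \<kappa>' {T..<T + r p} \<longleftrightarrow> inj_on f {T..<T + r p}"
      by (rule inj_on_cong) (simp add: \<kappa>'_def)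
    then show ?thesis using f True by (simp add: T_def bij_betw_def)
  next
    case False
    then have "(\<Sum>l<Suc i. r l) \<le> T" unfolding T_def
      using that by (intro sum_mono2) auto
    then have "inj_on \<kappa>' {\<Sum>l<i. r l..<\<Sum>l<Suc i. r l} \<longleftrightarrow> inj_on \<kappa> {\<Sum>l<i. r l..<\<Sum>l<Suc i. r l}"
      by (intro inj_on_cong) (simp add: \<kappa>'_def)
    then show ?thesis using \<kappa>(3) False that by simp
  qed
  ultimately show ?case unfolding T' by blast
qed

lemma interval_partition:
  fixes r :: "nat \<Rightarrow> nat"
  shows "(\<Union>i<p. {\<Sum>l<i. r l..<\<Sum>l<Suc i. r l}) = {..<\<Sum>i<p. r i}"
    and "disjoint_family_on (\<lambda>i. {\<Sum>l<i. r l..<\<Sum>l<Suc i. r l}) {..<p}"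
proof -
  show "(\<Union>i<p. {\<Sum>l<i. r l..<\<Sum>l<Suc i. r l}) = {..<\<Sum>i<p. r i}"
    by (induction p) (auto simp: lessThan_Suc)
  have "(\<Sum>l<Suc i. r l) \<le> (\<Sum>l<j. r l)" if "i < j" for i j
    using that by (intro sum_mono2) auto
  then have *: "{\<Sum>l<i. r l..<\<Sum>l<Suc i. r l} \<inter> {\<Sum>l<j. r l..<\<Sum>l<Suc j. r l} = {}" if "i < j" for i j
    using that by fastforce
  show "disjoint_family_on (\<lambda>i. {\<Sum>l<i. r l..<\<Sum>l<Suc i. r l}) {..<p}"
    unfolding disjoint_family_on_def using * by (metis inf_commute linorder_neqE_nat)
qed

text \<open>Because \<open>s\<close> is even, the interval splits into \<open>2 * h\<close> pairs of
  gap 1, and omitting after \<open>h\<close> pairs balances them. Both the unshifted and the shifted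
  copy of a row are covered by the choice of \<open>\<delta>\<close>.\<close>

lemma realises_row:
  assumes "even s" "0 < h" "0 \<le> \<delta>"
    and less: "\<And>t. t < s + 4 * h \<Longrightarrow> nonmultiple d t + \<delta> < int v"
  shows "\<exists>xs. realises v ((\<lambda>t. nonmultiple d t + \<delta>) ` {s..<s + 4 * h}) xs"
proof -
  obtain m where m: "s = 2 * m" using assms(1) by blast
  define a where "a i = nonmultiple d (s + i) + \<delta>" for i
  have gap: "a (2 * i + 1) - a (2 * i) = 1" for i
    using nonmultiple_odd[of d "m + i"] by (simp add: a_def m algebra_simps)
  have "\<exists>xs. realises v (a ` {..<2 * (2 * h)}) xs"
  proof (rule realises_balanced[where s = h])
    show "0 < a i" for i using nonmultiple_pos[of d "s + i"] assms(3) by (simp add: a_def)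
    show "a i < a j" if "i < j" for i j using that nonmultiple_strict_mono by (simp add: a_def)
    show "a i < int v" if "i < 2 * (2 * h)" for i using less that by (simp add: a_def)
    show "(\<Sum>i<h. a (2 * i + 1) - a (2 * i)) = (\<Sum>i = h..<2 * h. a (2 * i + 1) - a (2 * i))"
      by (simp only: gap) simp
  qed (use assms(2) in auto)
  moreover have "a ` {..<2 * (2 * h)} = (\<lambda>t. nonmultiple d t + \<delta>) ` ((+) s ` {0..<4 * h})"
    by (simp add: a_def image_image lessThan_atLeast0 del: image_add_atLeastLessThan)
  ultimately show ?thesis by (simp add: add.commute)
qed

text \<open>By \<open>e t \<le> \<delta>\<close> all shifted elements lie above the unshifted ones.
  As \<open>S\<close> has even size, no pair mixes the two kinds, so the gaps of the first
  \<open>k\<close> pairs recur in the last \<open>k\<close>.\<close>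

lemma realises_column:
  fixes e :: "nat \<Rightarrow> int"
  assumes "finite S" "card S = 2 * k" "0 < k"
    and mono: "\<And>s t. s \<in> S \<Longrightarrow> t \<in> S \<Longrightarrow> s < t \<Longrightarrow> e s < e t"
    and pos: "\<And>t. t \<in> S \<Longrightarrow> 0 < e t" and le: "\<And>t. t \<in> S \<Longrightarrow> e t \<le> \<delta>"
    and less: "\<And>t. t \<in> S \<Longrightarrow> e t + \<delta> < int v"
  shows "\<exists>xs. realises v (e ` S \<union> (\<lambda>t. e t + \<delta>) ` S) xs"
proof -
  define L where "L = sorted_list_of_set S"
  have L: "set L = S" "length L = 2 * k" "sorted_wrt (<) L"
    using assms(1,2) by (auto simp: L_def)
  define x where "x i = e (L ! i)" for i
  have in_S: "L ! i \<in> S" if "i < 2 * k" for i using L that nth_mem by metis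
  have x_mono: "x i < x j" if "i < j" "j < 2 * k" for i j
    unfolding x_def using that L in_S by (intro mono) (auto simp: sorted_wrt_nth_less)
  have x: "0 < x i" "x i \<le> \<delta>" "x i + \<delta> < int v" if "i < 2 * k" for i
    using in_S[OF that] pos le less by (auto simp: x_def)
  define a where "a i = (if i < 2 * k then x i else x (i - 2 * k) + \<delta>)" for i
  have "\<exists>xs. realises v (a ` {..<2 * (2 * k)}) xs"
  proof (rule realises_balanced[where s = k])
    have upper: "i - 2 * k < 2 * k" if "i < 2 * (2 * k)" for i using that by linarith
    have \<delta>: "0 < \<delta>" using x(1,2)[of 0] assms(3) by simp
    show "0 < a i" if "i < 2 * (2 * k)" for i
      using x(1)[of i] x(1)[OF upper[OF that]] \<delta> by (simp add: a_def)
    show "a i < int v" if "i < 2 * (2 * k)" for i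
      using x(3)[of i] x(3)[OF upper[OF that]] \<delta> by (auto simp: a_def)
    show "a i < a j" if "i < j" "j < 2 * (2 * k)" for i j
    proof (cases "j < 2 * k \<or> 2 * k \<le> i")
      case True
      then show ?thesis
        using that x_mono[of i j] x_mono[of "i - 2 * k" "j - 2 * k"] upper[OF that(2)]
        by (auto simp: a_def)
    next
      case False
      then show ?thesis using x(2)[of i] x(1)[OF upper[OF that(2)]] by (auto simp: a_def)
    qed
    have "(\<Sum>i = k..<2 * k. a (2 * i + 1) - a (2 * i)) =
        (\<Sum>i = 0..<k. a (2 * (i + k) + 1) - a (2 * (i + k)))"
      using sum.shift_bounds_nat_ivl[of "\<lambda>i. a (2 * i + 1) - a (2 * i)" 0 k k] by (simp add: mult_2)
    also have "\<dots> = (\<Sum>i<k. a (2 * i + 1) - a (2 * i))"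
      unfolding lessThan_atLeast0 by (intro sum.cong) (auto simp: a_def)
    finally show "(\<Sum>i<k. a (2 * i + 1) - a (2 * i)) = (\<Sum>i = k..<2 * k. a (2 * i + 1) - a (2 * i))"
      by simp
  qed (use assms(3) in auto)
  moreover have "a ` {..<2 * (2 * k)} = e ` S \<union> (\<lambda>t. e t + \<delta>) ` S"
  proof -
    have S: "S = (!) L ` {..<2 * k}" using L(1,2) by (auto simp: set_conv_nth)
    have "{..<2 * (2 * k)} = {..<2 * k} \<union> (+) (2 * k) ` {0..<2 * k}"
      by (auto simp: image_add_atLeastLessThan)
    then have "a ` {..<2 * (2 * k)} = a ` {..<2 * k} \<union> a ` (+) (2 * k) ` {..<2 * k}"
      by (simp only: image_Un lessThan_atLeast0)
    also have "a ` {..<2 * k} = x ` {..<2 * k}" by (rule image_cong) (auto simp: a_def)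
    also have "a ` (+) (2 * k) ` {..<2 * k} = (\<lambda>i. x i + \<delta>) ` {..<2 * k}"
      unfolding image_image by (rule image_cong) (auto simp: a_def)
    finally show ?thesis by (simp add: S image_image x_def)
  qed
  ultimately show ?thesis by simp
qed

text \<open>Row sums are the cycle lengths of the first decomposition, column sums half the cycle
  lengths of the second. The totals match the \<open>d * u\<close> differences, half of which are
  labelled by the ones of the matrix.\<close>

theorem orthogonal_decompositions_of_margins:
  fixes d u v p N :: nat and r c :: "nat \<Rightarrow> nat" and U :: "int set"
  assumes d: "0 < d" "0 < u" and v: "v = (2 * d + 1) * u" "[v = u] (mod 16)"
    and u: "u = 1 \<or> [u = 0] (mod 4)"
    and U: "subgroup U (integer_mod_group v)" "card U = u"
    and r: "\<And>i. i < p \<Longrightarrow> 0 < r i \<and> 4 dvd r i"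
    and c: "\<And>j. j < N \<Longrightarrow> 0 < c j \<and> even (c j)" "\<And>i j. i \<le> j \<Longrightarrow> j < N \<Longrightarrow> c j \<le> c i"
    and dominance: "\<And>w. 1 \<le> w \<Longrightarrow> w \<le> N \<Longrightarrow> (\<Sum>j<w. c j) \<le> (\<Sum>i<p. min (r i) w)"
    and total: "2 * (\<Sum>i<p. r i) = d * u" "2 * (\<Sum>j<N. c j) = d * u"
    and K: "K = cayley_complement (integer_mod_group v) U"
  shows "\<exists>\<F> \<F>'.
    cycle_decomposition K \<F> \<and> regular_under (integer_mod_group v) \<F> \<and>
    cycle_decomposition K \<F>' \<and> regular_under (integer_mod_group v) \<F>' \<and>
    orthogonal_decompositions \<F> \<F>' \<and> finite \<F> \<and> finite \<F>' \<and>
    cycle_lengths \<F> = repeat_mset (2 * v) (image_mset r (mset_set {..<p})) \<and>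
    cycle_lengths \<F>' = repeat_mset v (image_mset (\<lambda>j. 2 * c j) (mset_set {..<N}))"
proof -
  define H where "H = {a. 0 < a \<and> 2 * a < int v \<and> \<not> int (2 * d + 1) dvd a}"
  interpret difference_graph v H K
    unfolding H_def K using difference_graph_cayley_complement[OF v(1) _ d(2) U] by simp
  define e where "e = nonmultiple d"
  define start where "start i = (\<Sum>l<i. r l)" for i
  define T where "T = start p"
  have T: "T = d * u div 2" using total(1) by (simp add: T_def start_def)
  obtain \<delta> where le: "\<And>t. t < T \<Longrightarrow> e t \<le> \<delta>"
    and H_eq: "H = e ` {..<T} \<union> (\<lambda>t. e t + \<delta>) ` {..<T}"
    using half_set_split[OF d v u] unfolding H_def T e_def by blast
  have e_pos: "0 < e t" for t by (simp add: e_def nonmultiple_pos)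
  have e_mono: "s < t \<Longrightarrow> e s < e t" for s t by (simp add: e_def nonmultiple_strict_mono)
  have e_eq: "e s = e t \<longleftrightarrow> s = t" for s t
    using e_mono[of s t] e_mono[of t s] by (cases s t rule: linorder_cases) auto
  have half: "2 * (e t + \<delta>) < int v" if "t < T" for t
  proof -
    have "e t + \<delta> \<in> H" unfolding H_eq using that by blast
    then show ?thesis unfolding H_def by blast
  qed
  have \<delta>: "0 \<le> \<delta>" if "t < T" for t using le[OF that] e_pos[of t] by simp
  have less: "e t + \<delta> < int v" "e t < int v" if "t < T" for t
    using half[OF that] e_pos[of t] \<delta>[OF that] by auto
  \<comment> \<open>\<open>e s\<close> is at most \<open>\<delta>\<close>, while
    \<open>e t + \<delta>\<close> exceeds it.\<close>
  have low_high: "e s \<noteq> e t + \<delta>" if "s < T" for s t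
    using le[OF that] e_pos[of t] by simp

  obtain M where M: "\<forall>i\<in>{..<p}. card {j. j < N \<and> M i j} = r i"
    "\<forall>j<N. card {i\<in>{..<p}. M i j} = c j"
  proof -
    have "(\<Sum>j<w. c j) \<le> (\<Sum>i<p. min (r i) w)" if "w \<le> N" for w
      using dominance[of w] that by (cases "w = 0") auto
    then have "\<exists>M. (\<forall>i\<in>{..<p}. card {j. j < N \<and> M i j} = r i) \<and>
        (\<forall>j<N. card {i\<in>{..<p}. M i j} = c j)"
      using c(2) total by (intro gale_ryser) auto
    then show thesis using that by blast
  qed
  have "card {j. j < N \<and> M i j} = r i" if "i < p" for i using M(1) that by simp
  from row_column_labelling[where p = p and N = N and M = M and r = r, OF this] obtain \<kappa> where
    "\<And>j. j < N \<Longrightarrow> card {t. t < T \<and> \<kappa> t = j} = card {i\<in>{..<p}. M i j}"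
    and \<kappa>: "\<And>t. t < T \<Longrightarrow> \<kappa> t < N" "\<And>i. i < p \<Longrightarrow> inj_on \<kappa> {start i..<start (Suc i)}"
    unfolding T_def start_def by blast
  then have card_label: "card {t. t < T \<and> \<kappa> t = j} = c j" if "j < N" for j
    using M(2) that by simp
  define S where "S j = {t. t < T \<and> \<kappa> t = j}" for j
  have rows: "(\<Union>i<p. {start i..<start (Suc i)}) = {..<T}"
    "disjoint_family_on (\<lambda>i. {start i..<start (Suc i)}) {..<p}"
    unfolding T_def start_def by (rule interval_partition)+

  \<comment> \<open>The Boolean selects the shifted or the unshifted copy of a row; two blocks per
    row account for the multiplicity \<open>2 * v\<close>.\<close>
  define B where "B = {..<p} \<times> (UNIV :: bool set)"
  define A where "A = (\<lambda>(i, b). (\<lambda>t. e t + (if b then \<delta> else 0)) ` {start i..<start (Suc i)})"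
  define A' where "A' j = e ` S j \<union> (\<lambda>t. e t + \<delta>) ` S j" for j
  have start_le: "start (Suc i) \<le> T" if "i < p" for i
    unfolding T_def start_def using that by (intro sum_mono2) auto

  have "\<exists>xs. realises v (A (i, b)) xs" if i: "i < p" for i b
  proof -
    obtain h where h: "r i = 4 * h" using r[OF i] by blast
    \<comment> \<open>Divisibility of the row sums by 4 keeps every row aligned with the pairs of
      consecutive differences.\<close>
    have "even (start i)"
      unfolding start_def using r i by (intro dvd_sum) (meson dvd_trans even_numeral lessThan_iff order_less_trans)
    moreover have suc: "start (Suc i) = start i + 4 * h" by (simp add: start_def h)
    moreover have "0 < r i" using r i by blast
    then have "0 < h" and "start i < T" using h start_le[OF i] suc by auto
    ultimately show ?thesis
      using realises_row[of "start i" h "if b then \<delta> else 0" d v] less start_le[OF i] \<delta>[of "start i"]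
      by (auto simp: A_def e_def)
  qed
  then have "\<forall>b\<in>B. \<exists>xs. realises v (A b) xs" by (auto simp: B_def)
  then obtain xs where xs: "\<forall>b\<in>B. realises v (A b) (xs b)"
    using bchoice[of B "\<lambda>b. realises v (A b)"] by blast
  have fam: "base_family B A xs"
    unfolding base_family_def
  proof (intro conjI ballI)
    show "disjoint_family_on A B"
      unfolding disjoint_family_on_def
    proof (intro ballI impI)
      fix x y assume xy: "x \<in> B" "y \<in> B" "x \<noteq> y"
      obtain i b where x: "x = (i, b)" by fastforce
      obtain j b' where y: "y = (j, b')" by fastforce
      have ij: "i < p" "j < p" using xy x y by (auto simp: B_def)
      have lt: "t < T" if "t < start (Suc i) \<or> t < start (Suc j)" for t
        using that start_le ij by fastforce
      have key: "s = t \<and> b = b'" if "e s + (if b then \<delta> else 0) = e t + (if b' then \<delta> else 0)"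
        "s < T" "t < T" for s t
        using that low_high[of s t] low_high[of t s] e_eq by (auto split: if_splits)
      have intervals: "{start i..<start (Suc i)} \<inter> {start j..<start (Suc j)} = {}" if "i \<noteq> j"
        using rows(2) ij that by (auto simp: disjoint_family_on_def)
      have False if z: "z \<in> A x" "z \<in> A y" for z
      proof -
        obtain s where s: "s \<in> {start i..<start (Suc i)}" "z = e s + (if b then \<delta> else 0)"
          using z(1) unfolding x A_def prod.case by blast
        obtain t where t: "t \<in> {start j..<start (Suc j)}" "z = e t + (if b' then \<delta> else 0)"
          using z(2) unfolding y A_def prod.case by blast
        have "s = t" "b = b'" using key[of s t] s t lt by auto
        then show False using intervals s(1) t(1) xy(3) x y by blast
      qed
      then show "A x \<inter> A y = {}" by blast
    qed
    have "(\<Union>b\<in>B. A b) = (\<Union>b. (\<lambda>t. e t + (if b then \<delta> else 0)) ` (\<Union>i<p. {start i..<start (Suc i)}))"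
      by (auto simp: B_def A_def)
    also have "\<dots> = H" unfolding rows H_eq by (auto simp: UNIV_bool)
    finally show "(\<Union>b\<in>B. A b) = H" .
  qed (auto simp: B_def xs)

  have "\<exists>ys. realises v (A' j) ys" if j: "j < N" for j
  proof -
    obtain k where k: "c j = 2 * k" using c(1)[OF j] by blast
    then show ?thesis
      unfolding A'_def using card_label[OF j] c(1)[OF j] e_mono e_pos le less
      by (intro realises_column[where k = k]) (auto simp: S_def)
  qed
  then obtain ys where ys: "\<And>j. j < N \<Longrightarrow> realises v (A' j) (ys j)" by metis
  have fam': "base_family {..<N} A' ys"
    unfolding base_family_def
  proof (intro conjI ballI)
    show "disjoint_family_on A' {..<N}"
      unfolding disjoint_family_on_def
    proof (intro ballI impI)
      have label: "\<exists>t<T. \<kappa> t = j \<and> (z = e t \<or> z = e t + \<delta>)" if "z \<in> A' j" for z j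
        using that by (auto simp: A'_def S_def)
      fix i j :: nat assume "i \<noteq> j"
      have False if z: "z \<in> A' i" "z \<in> A' j" for z
      proof -
        obtain s where s: "s < T" "\<kappa> s = i" "z = e s \<or> z = e s + \<delta>" using label[OF z(1)] by blast
        obtain t where t: "t < T" "\<kappa> t = j" "z = e t \<or> z = e t + \<delta>" using label[OF z(2)] by blast
        have "s = t"
          using s(3) t(3) low_high[OF s(1), of t] low_high[OF t(1), of s] e_eq by auto
        then show False using s(2) t(2) \<open>i \<noteq> j\<close> by simp
      qed
      then show "A' i \<inter> A' j = {}" by blast
    qed
    have "(\<Union>j<N. S j) = {..<T}" using \<kappa>(1) by (auto simp: S_def)
    then show "(\<Union>j<N. A' j) = H" unfolding H_eq A'_def by blast
  qed (auto simp: ys)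

  \<comment> \<open>A common difference comes from an index of row \<open>i\<close> with label
    \<open>j\<close>. Only one such index exists, and the Boolean fixes which of its two differences
    is meant.\<close>
  have orth: "card (A b \<inter> A' j) \<le> 1" if "b \<in> B" "j \<in> {..<N}" for b j
  proof -
    obtain i s where b: "b = (i, s)" "i < p" using \<open>b \<in> B\<close> by (auto simp: B_def)
    have "x = y" if "x \<in> A b \<inter> A' j" "y \<in> A b \<inter> A' j" for x y
    proof -
      have "\<exists>t. t \<in> {start i..<start (Suc i)} \<and> \<kappa> t = j \<and> z = e t + (if s then \<delta> else 0)"
        if "z \<in> A b \<inter> A' j" for z
      proof -
        obtain t where t: "t \<in> {start i..<start (Suc i)}" "z = e t + (if s then \<delta> else 0)"
          using \<open>z \<in> A b \<inter> A' j\<close> by (auto simp: A_def b)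
        then have "t < T" using start_le[OF b(2)] by simp
        obtain t' where t': "t' < T" "\<kappa> t' = j" "z = e t' \<or> z = e t' + \<delta>"
          using \<open>z \<in> A b \<inter> A' j\<close> by (auto simp: A'_def S_def)
        have "t = t'" using t(2) t'(1,3) low_high[OF \<open>t < T\<close>, of t'] low_high[OF t'(1), of t] e_eq
          by (auto split: if_splits)
        then show ?thesis using t t' by blast
      qed
      then show ?thesis using that \<kappa>(2)[OF b(2)] by (metis inj_onD)
    qed
    then have "\<exists>z. A b \<inter> A' j \<subseteq> {z}" by blast
    then show ?thesis by (metis card_mono finite.emptyI finite_insert is_singletonI is_singleton_altdef)
  qed

  have card_A: "card (A b) = r (fst b)" if "b \<in> B" for b
  proof -
    have "inj_on (\<lambda>t. e t + (if snd b then \<delta> else 0)) X" for X by (auto simp: inj_on_def e_eq)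
    then show ?thesis by (simp add: A_def case_prod_unfold card_image start_def)
  qed
  have card_A': "card (A' j) = 2 * c j" if j: "j < N" for j
  proof -
    have "card (A' j) = card (e ` S j) + card ((\<lambda>t. e t + \<delta>) ` S j)"
      unfolding A'_def by (rule card_Un_disjoint) (auto simp: S_def low_high)
    moreover have "inj_on e (S j)" "inj_on (\<lambda>t. e t + \<delta>) (S j)" by (auto simp: inj_on_def e_eq)
    ultimately show ?thesis using card_label[OF j] by (simp add: card_image S_def)
  qed
  have "cycle_lengths (develop B xs) = repeat_mset v (image_mset (\<lambda>b. r (fst b)) (mset_set B))"
    unfolding cycle_lengths_develop[OF fam] using card_A
    by (intro arg_cong[where f = "repeat_mset v"] image_mset_cong) (auto simp: B_def)
  also have "image_mset (\<lambda>b. r (fst b)) (mset_set B) = repeat_mset 2 (image_mset r (mset_set {..<p}))"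
  proof -
    have "B = (\<lambda>i. (i, False)) ` {..<p} \<union> (\<lambda>i. (i, True)) ` {..<p}"
      unfolding B_def UNIV_bool by auto
    then have "mset_set B = mset_set ((\<lambda>i. (i, False)) ` {..<p}) + mset_set ((\<lambda>i. (i, True)) ` {..<p})"
      by (simp only:) (rule mset_set_Union, auto)
    then show ?thesis
      by (simp add: image_mset_mset_set[symmetric] inj_on_def multiset.map_comp o_def
        numeral_2_eq_2)
  qed
  finally have len: "cycle_lengths (develop B xs) = repeat_mset (2 * v) (image_mset r (mset_set {..<p}))"
    by (simp add: mult.commute)
  have len': "cycle_lengths (develop {..<N} ys) =
      repeat_mset v (image_mset (\<lambda>j. 2 * c j) (mset_set {..<N}))"
    unfolding cycle_lengths_develop[OF fam'] using card_A'
    by (intro arg_cong[where f = "repeat_mset v"] image_mset_cong) auto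
  have "finite (develop B xs)" "finite (develop {..<N} ys)"
    by (simp_all add: develop_def B_def)
  then show ?thesis
    using decomposition_develop[OF fam] decomposition_develop[OF fam'] regular_develop[OF fam]
      regular_develop[OF fam'] orthogonal_develop[OF fam fam' orth] len len'
    by blast
qed

section \<open>From sequences to margins: lists, multisets and the two choices of parameters\<close>

lemma length_twice_each: "length (twice_each xs) = 2 * length xs"
  by (induction xs) (auto simp: twice_each_def)

lemma set_twice_each: "set (twice_each xs) = set xs"
  by (induction xs) (auto simp: twice_each_def)

lemma sum_list_map_twice_each:
  fixes f :: "'b \<Rightarrow> nat"
  shows "sum_list (map f (twice_each xs)) = (\<Sum>x\<leftarrow>xs. 2 * f x)"
  by (induction xs) (auto simp: twice_each_def)

lemma image_mset_nth: "image_mset (\<lambda>i. f (xs ! i)) (mset_set {..<length xs}) = mset (map f xs)"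
proof -
  have "map f xs = map (\<lambda>i. f (xs ! i)) [0..<length xs]" by (rule nth_equalityI) auto
  then have "mset (map f xs) = image_mset (\<lambda>i. f (xs ! i)) (mset [0..<length xs])"
    by (simp only: mset_map)
  then show ?thesis by (simp only: mset_upt lessThan_atLeast0)
qed

lemma in_repeat_msetD: "x \<in># repeat_mset n A \<Longrightarrow> x \<in># A"
  by (metis count_eq_zero_iff count_repeat_mset mult_0_right)

lemma decreasing_reordering_antimono:
  assumes "i \<le> j" "j < length xs"
  shows "decreasing_reordering xs ! j \<le> decreasing_reordering xs ! i"
  unfolding decreasing_reordering_def using assms
  by (simp add: rev_nth sorted_nth_mono)

theorem theorem6p9:
  fixes d u v :: nat and U :: "int set" and K :: "int ugraph"
  assumes "0 < d" and "0 < u" and "v = (2 * d + 1) * u"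
    and "[v = u] (mod 16)" and "u = 1 \<or> [u = 0] (mod 4)"
    and "subgroup U (integer_mod_group v)" and "card U = u"
    and "K = cayley_complement (integer_mod_group v) U"
  shows
    "(\<forall>h k m n :: nat.
        0 < h \<and> 0 < k \<and> 0 < m \<and> 0 < n \<and> 4 * h \<le> n \<and> 2 * k \<le> m \<and>
        8 * h * m = 4 * k * n \<and> 4 * k * n = d * u \<longrightarrow>
        (\<exists>\<F> \<F>'.
           cycle_decomposition K \<F> \<and> regular_under (integer_mod_group v) \<F> \<and>
           cycle_decomposition K \<F>' \<and> regular_under (integer_mod_group v) \<F>' \<and>
           orthogonal_decompositions \<F> \<F>' \<and>
           (\<forall>C\<in>\<F>. cycle_length C = 4 * h) \<and> (\<forall>C\<in>\<F>'. cycle_length C = 4 * k)))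
     \<and>
     (\<forall>(m :: nat) (n :: nat) (h :: nat list) (k :: nat list) (hh :: nat list) (kk :: nat list).
        length h = m \<and> length k = n \<and> (\<forall>x\<in>set h. 0 < x) \<and> (\<forall>x\<in>set k. 0 < x) \<and>
        hh = twice_each h \<and> kk = twice_each k \<and>
        8 * sum_list hh = 4 * sum_list kk \<and> 4 * sum_list kk = d * u \<and>
        (\<forall>w\<in>{1..2 * n}.
           (\<Sum>i<m. 2 * min (4 * (h ! i)) w) \<ge> (\<Sum>j<w. decreasing_reordering (scale 2 kk) ! j)) \<longrightarrow>
        (\<exists>\<F> \<F>'.
           cycle_decomposition K \<F> \<and> regular_under (integer_mod_group v) \<F> \<and>
           cycle_decomposition K \<F>' \<and> regular_under (integer_mod_group v) \<F>' \<and>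
           orthogonal_decompositions \<F> \<F>' \<and>
           cycle_lengths \<F> = repeat_mset (2 * v) (mset (scale 4 hh)) \<and>
           cycle_lengths \<F>' = repeat_mset v (mset (scale 4 kk))))"
proof (intro conjI allI impI; elim conjE)
  have main: "\<exists>\<F> \<F>'.
      cycle_decomposition K \<F> \<and> regular_under (integer_mod_group v) \<F> \<and>
      cycle_decomposition K \<F>' \<and> regular_under (integer_mod_group v) \<F>' \<and>
      orthogonal_decompositions \<F> \<F>' \<and> finite \<F> \<and> finite \<F>' \<and>
      cycle_lengths \<F> = repeat_mset (2 * v) (image_mset r (mset_set {..<p})) \<and>
      cycle_lengths \<F>' = repeat_mset v (image_mset (\<lambda>j. 2 * c j) (mset_set {..<N}))"
    if "\<And>i. i < p \<Longrightarrow> 0 < r i \<and> 4 dvd r i" "\<And>j. j < N \<Longrightarrow> 0 < c j \<and> even (c j)"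
      "\<And>i j. i \<le> j \<Longrightarrow> j < N \<Longrightarrow> c j \<le> c i"
      "\<And>w. 1 \<le> w \<Longrightarrow> w \<le> N \<Longrightarrow> (\<Sum>j<w. c j) \<le> (\<Sum>i<p. min (r i) w)"
      "2 * (\<Sum>i<p. r i) = d * u" "2 * (\<Sum>j<N. c j) = d * u" for p N :: nat and r c
    by (rule orthogonal_decompositions_of_margins[OF assms(1-7) that assms(8)])
  {
    fix h k m n :: nat
    assume pos: "0 < h" "0 < k" "0 < m" "0 < n" and le: "4 * h \<le> n" "2 * k \<le> m"
      and total: "8 * h * m = 4 * k * n" "4 * k * n = d * u"
    \<comment> \<open>Up to \<open>w = 4 * h\<close> the right side is \<open>m * w\<close>, and
      \<open>2 * k \<le> m\<close> suffices. Beyond that it stays at its full value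
      \<open>m * (4 * h) = n * (2 * k)\<close>.\<close>
    have dom: "w * (2 * k) \<le> m * min (4 * h) w" if "w \<le> n" for w
    proof (cases "w \<le> 4 * h")
      case True
      then show ?thesis using mult_le_mono2[OF le(2), of w] by (simp add: min_def mult.commute)
    next
      case False
      have "w * (2 * k) \<le> n * (2 * k)" using that by (rule mult_le_mono1)
      also have "\<dots> = m * (4 * h)" using total(1) by (simp add: mult_ac)
      finally show ?thesis using False by simp
    qed
    have "2 * (\<Sum>i<m. 4 * h) = d * u" "2 * (\<Sum>j<n. 2 * k) = d * u"
      using total by (simp_all add: mult_ac)
    then obtain \<F> \<F>' where F: "cycle_decomposition K \<F>" "regular_under (integer_mod_group v) \<F>"
      "cycle_decomposition K \<F>'" "regular_under (integer_mod_group v) \<F>'"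
      "orthogonal_decompositions \<F> \<F>'" "finite \<F>" "finite \<F>'"
      "cycle_lengths \<F> = repeat_mset (2 * v) (image_mset (\<lambda>_. 4 * h) (mset_set {..<m}))"
      "cycle_lengths \<F>' = repeat_mset v (image_mset (\<lambda>_. 2 * (2 * k)) (mset_set {..<n}))"
      using main[of m "\<lambda>_. 4 * h" n "\<lambda>_. 2 * k"] pos dom by auto
    \<comment> \<open>Finiteness matters here, since \<open>mset_set\<close> of an infinite set is
      empty.\<close>
    have "cycle_length C \<in># cycle_lengths \<F>" if "C \<in> \<F>" for C
      using that F(6) by (simp add: cycle_lengths_def)
    then have "\<forall>C\<in>\<F>. cycle_length C = 4 * h"
      unfolding F(8) by (fastforce dest: in_repeat_msetD)
    moreover have "cycle_length C \<in># cycle_lengths \<F>'" if "C \<in> \<F>'" for C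
      using that F(7) by (simp add: cycle_lengths_def)
    then have "\<forall>C\<in>\<F>'. cycle_length C = 4 * k"
      unfolding F(9) by (fastforce dest: in_repeat_msetD)
    ultimately show "\<exists>\<F> \<F>'.
        cycle_decomposition K \<F> \<and> regular_under (integer_mod_group v) \<F> \<and>
        cycle_decomposition K \<F>' \<and> regular_under (integer_mod_group v) \<F>' \<and>
        orthogonal_decompositions \<F> \<F>' \<and>
        (\<forall>C\<in>\<F>. cycle_length C = 4 * h) \<and> (\<forall>C\<in>\<F>'. cycle_length C = 4 * k)"
      using F(1-5) by blast
  next
    fix m n :: nat and h k hh kk :: "nat list"
    assume len: "length h = m" "length k = n"
      and pos: "\<forall>x\<in>set h. 0 < x" "\<forall>x\<in>set k. 0 < x"
      and hk: "hh = twice_each h" "kk = twice_each k"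
      and total: "8 * sum_list hh = 4 * sum_list kk" "4 * sum_list kk = d * u"
      and dom: "\<forall>w\<in>{1..2 * n}. (\<Sum>j<w. decreasing_reordering (scale 2 kk) ! j)
        \<le> (\<Sum>i<m. 2 * min (4 * (h ! i)) w)"
    \<comment> \<open>The column sums must be nonincreasing; sorting them leaves the multiset of
      cycle lengths unchanged.\<close>
    define cs where "cs = decreasing_reordering (scale 2 kk)"
    have cs: "mset cs = mset (scale 2 kk)" by (simp add: cs_def decreasing_reordering_def)
    have len2: "length hh = 2 * m" "length cs = 2 * n" "length (scale 2 kk) = 2 * n"
      by (simp_all add: hk len length_twice_each cs_def decreasing_reordering_def scale_def)
    have set_cs: "set cs = (\<lambda>x. 2 * x) ` set k"
      by (simp add: cs_def decreasing_reordering_def scale_def hk set_twice_each)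
    have sum_nth: "(\<Sum>i<length xs. f (xs ! i)) = sum_list (map f xs)" for f :: "nat \<Rightarrow> nat" and xs
      by (simp add: sum_list_sum_nth lessThan_atLeast0)
    have "\<exists>\<F> \<F>'.
        cycle_decomposition K \<F> \<and> regular_under (integer_mod_group v) \<F> \<and>
        cycle_decomposition K \<F>' \<and> regular_under (integer_mod_group v) \<F>' \<and>
        orthogonal_decompositions \<F> \<F>' \<and> finite \<F> \<and> finite \<F>' \<and>
        cycle_lengths \<F> = repeat_mset (2 * v) (image_mset (\<lambda>i. 4 * (hh ! i)) (mset_set {..<length hh})) \<and>
        cycle_lengths \<F>' = repeat_mset v (image_mset (\<lambda>j. 2 * (cs ! j)) (mset_set {..<length cs}))"
    proof (rule main)
      show "0 < 4 * (hh ! i) \<and> 4 dvd 4 * (hh ! i)" if "i < length hh" for i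
        using pos(1) nth_mem[OF that] by (simp add: hk set_twice_each)
      show "0 < cs ! j \<and> even (cs ! j)" if "j < length cs" for j
        using pos(2) nth_mem[OF that] unfolding set_cs by auto
      show "cs ! j \<le> cs ! i" if "i \<le> j" "j < length cs" for i j
        unfolding cs_def using that len2 by (intro decreasing_reordering_antimono) auto
      show "(\<Sum>j<w. cs ! j) \<le> (\<Sum>i<length hh. min (4 * (hh ! i)) w)" if "1 \<le> w" "w \<le> length cs" for w
      proof -
        \<comment> \<open>Every term of \<open>h\<close> appears twice in \<open>hh\<close>, which
          produces the factor 2 of the dominance condition.\<close>
        have "(\<Sum>i<length hh. min (4 * (hh ! i)) w) = (\<Sum>i<m. 2 * min (4 * (h ! i)) w)"
          unfolding sum_nth[where f = "\<lambda>x. min (4 * x) w"] len(1)[symmetric]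
          by (simp only: hk sum_list_map_twice_each sum_nth[where f = "\<lambda>x. 2 * min (4 * x) w"])
        then show ?thesis using dom that len2(2) unfolding cs_def by simp
      qed
      show "2 * (\<Sum>i<length hh. 4 * (hh ! i)) = d * u"
        using total sum_nth[of "\<lambda>x. 4 * x" hh] by (simp add: sum_list_const_mult)
      have "(\<Sum>j<length cs. cs ! j) = sum_list cs" using sum_nth[of "\<lambda>x. x" cs] by simp
      also have "\<dots> = sum_list (scale 2 kk)" using cs by (metis sum_mset_sum_list)
      finally show "2 * (\<Sum>j<length cs. cs ! j) = d * u"
        using total(2) by (simp add: scale_def sum_list_const_mult)
    qed
    moreover have "image_mset (\<lambda>i. 4 * (hh ! i)) (mset_set {..<length hh}) = mset (scale 4 hh)"
      by (simp only: image_mset_nth[where f = "\<lambda>x. 4 * x"] scale_def)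
    moreover have "image_mset (\<lambda>j. 2 * (cs ! j)) (mset_set {..<length cs}) = mset (scale 4 kk)"
    proof -
      have "image_mset (\<lambda>j. 2 * (cs ! j)) (mset_set {..<length cs}) = image_mset (\<lambda>x. 2 * x) (mset cs)"
        by (simp only: image_mset_nth[where f = "\<lambda>x. 2 * x"] mset_map)
      also have "\<dots> = mset (scale 4 kk)"
        unfolding cs by (simp add: scale_def multiset.map_comp o_def)
      finally show ?thesis .
    qed
    ultimately show "\<exists>\<F> \<F>'.
        cycle_decomposition K \<F> \<and> regular_under (integer_mod_group v) \<F> \<and>
        cycle_decomposition K \<F>' \<and> regular_under (integer_mod_group v) \<F>' \<and>
        orthogonal_decompositions \<F> \<F>' \<and>
        cycle_lengths \<F> = repeat_mset (2 * v) (mset (scale 4 hh)) \<and>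
        cycle_lengths \<F>' = repeat_mset v (mset (scale 4 kk))"
      by auto
  }
qed

end
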